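(* Let $n\ge1$ and let $\mathcal{G}$ be a subgroup with $\mathcal{M}^+_{2n}\le\mathcal{G}\le\mathcal{C}^p_{2n}$, and let $G\le\mathrm{O}(2n)$ be the set of symplectic maps associated to elements of $\mathcal{G}$. Then for every integer $t\ge1$, $$\mathcal{F}^+_t(\mathcal{G})=\frac{1}{|G|}\sum_{S\in G}\left[\frac{f_+(S)+c_+(S)}{2}\right]^{t-1},$$ where $f_+(S)=|\{v\in\mathbb{F}_2^{2n,+}:Sv=v\}|$ and $c_+(S)=|\{v\in\mathbb{F}_2^{2n,+}:Sv=v+j\}|$.
   Context: All binary arithmetic is over $\mathbb{F}_2$. $\chi_1,\dots,\chi_{2n}$ are Hermitian operators on a $2^n$-dimensional Hilbert space with $\chi_i\chi_k+\chi_k\chi_i=2\delta_{ik}I$; $\omega_L$ is the strictly lower triangular binary matrix of ones below the diagonal; $\mu(v)=i^{\,v^T\omega_L v}\chi_1^{v_1}\cdots\chi_{2n}^{v_{2n}}$. $j=(1,\dots,1)^T$, $\mathbb{F}_2^{2n,+}$ is the set of even-weight vectors, $\mathcal{M}^+_{2n}=\{i^a\mu(v):a\in\mathbb{Z}_4,v\in\mathbb{F}_2^{2n,+}\}$. The Majorana Clifford group $\mathcal{C}_{2n}$ consists of unitaries $\gamma$ with $\gamma\mu(v)\gamma^\dagger=c(v)\mu(S(v))$ for all $v$ (some $c,S$; $S$ is the associated symplectic map), and $\mathcal{C}^p_{2n}=\{\gamma\in\mathcal{C}_{2n}:\gamma\mu(j)=\mu(j)\gamma\}$, whose associated maps lie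 in $\mathrm{O}(2n)=\{A: A^TA=AA^T=I\}$. Let $\Pi_+=\frac12(I+\mu(j))$ be the projector onto the even-parity subspace. For a parity-preserving group $\mathcal{G}$ of unitaries, the parity-restricted frame potential is $\mathcal{F}^+_t(\mathcal{G})=\mathbb{E}_{U,V\in\mathcal{G}}|\operatorname{tr}(\Pi_+UV^\dagger)|^{2t}=\mathbb{E}_{U\in\mathcal{G}}|\operatorname{tr}(\Pi_+U)|^{2t}$, the expectation being uniform over $\mathcal{G}$ modulo global phases. *)

theory Defs
  imports "Jordan_Normal_Form.Matrix" "HOL-Library.FuncSet"
begin

definition adj :: "complex mat \<Rightarrow> complex mat" where
  "adj A = mat (dim_col A) (dim_row A) (\<lambda>(i,k). cnj (A $$ (k,i)))"

definition mtrace :: "complex mat \<Rightarrow> complex" where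
  "mtrace A = (\<Sum>i<dim_row A. A $$ (i,i))"

definition unitary_mat :: "nat \<Rightarrow> complex mat \<Rightarrow> bool" where
  "unitary_mat N U \<longleftrightarrow> U \<in> carrier_mat N N \<and> U * adj U = 1\<^sub>m N \<and> adj U * U = 1\<^sub>m N"

section \<open>Binary vectors in F_2^{2n}, represented as supports (subsets of {0..<2n})\<close>

definition F2vecs :: "nat \<Rightarrow> nat set set" where
  "F2vecs n = Pow {0..<2*n}"

definition F2vecs_even :: "nat \<Rightarrow> nat set set" where
  "F2vecs_even n = {v \<in> F2vecs n. even (card v)}"

definition jvec :: "nat \<Rightarrow> nat set" where
  "jvec n = {0..<2*n}"

definition vadd :: "nat set \<Rightarrow> nat set \<Rightarrow> nat set" where
  "vadd v w = (v - w) \<union> (w - v)"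

text \<open>v^T omega_L v over F_2 (omega_L strictly lower triangular all ones).\<close>
definition omegaL_form :: "nat set \<Rightarrow> nat" where
  "omegaL_form v = card {(i,k). i \<in> v \<and> k \<in> v \<and> k < i} mod 2"

definition majorana_family :: "nat \<Rightarrow> (nat \<Rightarrow> complex mat) \<Rightarrow> bool" where
  "majorana_family n chi \<longleftrightarrow>
     (\<forall>i<2*n. chi i \<in> carrier_mat (2^n) (2^n) \<and> adj (chi i) = chi i) \<and>
     (\<forall>i<2*n. \<forall>k<2*n. chi i * chi k + chi k * chi i =
        (if i = k then 2 \<cdot>\<^sub>m 1\<^sub>m (2^n) else 0\<^sub>m (2^n) (2^n)))"

definition chi_prod :: "nat \<Rightarrow> (nat \<Rightarrow> complex mat) \<Rightarrow> nat set \<Rightarrow> complex mat" where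
  "chi_prod n chi v = foldr (\<lambda>k M. (if k \<in> v then chi k else 1\<^sub>m (2^n)) * M) [0..<2*n] (1\<^sub>m (2^n))"

definition mu :: "nat \<Rightarrow> (nat \<Rightarrow> complex mat) \<Rightarrow> nat set \<Rightarrow> complex mat" where
  "mu n chi v = (\<i> ^ omegaL_form v) \<cdot>\<^sub>m chi_prod n chi v"

definition assoc_map :: "nat \<Rightarrow> (nat \<Rightarrow> complex mat) \<Rightarrow> complex mat \<Rightarrow> (nat set \<Rightarrow> nat set) \<Rightarrow> bool" where
  "assoc_map n chi \<gamma> S \<longleftrightarrow> S \<in> F2vecs n \<rightarrow>\<^sub>E F2vecs n \<and>
     (\<exists>c :: nat set \<Rightarrow> complex. \<forall>v \<in> F2vecs n.
        \<gamma> * mu n chi v * adj \<gamma> = c v \<cdot>\<^sub>m mu n chi (S v))"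

definition Clifford :: "nat \<Rightarrow> (nat \<Rightarrow> complex mat) \<Rightarrow> complex mat set" where
  "Clifford n chi = {\<gamma>. unitary_mat (2^n) \<gamma> \<and> (\<exists>S. assoc_map n chi \<gamma> S)}"

definition Clifford_p :: "nat \<Rightarrow> (nat \<Rightarrow> complex mat) \<Rightarrow> complex mat set" where
  "Clifford_p n chi = {\<gamma> \<in> Clifford n chi. \<gamma> * mu n chi (jvec n) = mu n chi (jvec n) * \<gamma>}"

definition Majorana_even :: "nat \<Rightarrow> (nat \<Rightarrow> complex mat) \<Rightarrow> complex mat set" where
  "Majorana_even n chi = {(\<i> ^ a) \<cdot>\<^sub>m mu n chi v | a v. a < 4 \<and> v \<in> F2vecs_even n}"

definition unitary_subgroup :: "nat \<Rightarrow> complex mat set \<Rightarrow> bool" where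
  "unitary_subgroup N \<G> \<longleftrightarrow> (\<forall>U\<in>\<G>. unitary_mat N U) \<and> 1\<^sub>m N \<in> \<G> \<and>
     (\<forall>U\<in>\<G>. \<forall>V\<in>\<G>. U * V \<in> \<G>) \<and> (\<forall>U\<in>\<G>. adj U \<in> \<G>)"

definition assoc_maps :: "nat \<Rightarrow> (nat \<Rightarrow> complex mat) \<Rightarrow> complex mat set \<Rightarrow> (nat set \<Rightarrow> nat set) set" where
  "assoc_maps n chi \<G> = {S. \<exists>\<gamma>\<in>\<G>. assoc_map n chi \<gamma> S}"

definition Pi_plus :: "nat \<Rightarrow> (nat \<Rightarrow> complex mat) \<Rightarrow> complex mat" where
  "Pi_plus n chi = (1/2 :: complex) \<cdot>\<^sub>m (1\<^sub>m (2^n) + mu n chi (jvec n))"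

definition phase_rel :: "complex mat set \<Rightarrow> (complex mat \<times> complex mat) set" where
  "phase_rel \<G> = {(U,V). U \<in> \<G> \<and> V \<in> \<G> \<and> (\<exists>z. cmod z = 1 \<and> U = z \<cdot>\<^sub>m V)}"

text \<open>E_{U,V in G} |tr(Pi_+ U V^dagger)|^{2t}, uniform over G modulo global phases
  (the integrand is phase-invariant, so any representative of a class may be used).\<close>
definition frame_potential_plus :: "nat \<Rightarrow> (nat \<Rightarrow> complex mat) \<Rightarrow> nat \<Rightarrow> complex mat set \<Rightarrow> real" where
  "frame_potential_plus n chi t \<G> =
     (let Q = \<G> // phase_rel \<G>; rep = (\<lambda>X. SOME U. U \<in> X) in
      (\<Sum>X\<in>Q. \<Sum>Y\<in>Q. cmod (mtrace (Pi_plus n chi * rep X * adj (rep Y))) ^ (2*t))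
        / (real (card Q))^2)"

definition f_plus :: "nat \<Rightarrow> (nat set \<Rightarrow> nat set) \<Rightarrow> nat" where
  "f_plus n S = card {v \<in> F2vecs_even n. S v = v}"

definition c_plus :: "nat \<Rightarrow> (nat set \<Rightarrow> nat set) \<Rightarrow> nat" where
  "c_plus n S = card {v \<in> F2vecs_even n. S v = vadd v (jvec n)}"

end

(* Since the 4^n operators mu(v) are orthogonal for the trace form, they are a basis of the
   2^n x 2^n matrices, which yields the twirl sum_v mu(v) A mu(v)^* = 2^n tr(A) I and a Parseval
   identity. Restricting the twirl to even v gives, for a parity-preserving Clifford element g with
   associated map S, that 2 |tr(Pi_+ g)|^2 = sum_{v in H} ch(v), where H is the group of even v with
   Sv = v or Sv = v + j, and ch is the character of H with Pi_+ g mu(v) g^* = ch(v) Pi_+ mu(v).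
   Hence |tr(Pi_+ g)|^2 is either 0 or |H|/2 = (f_+ + c_+)/2. Modulo phases, the group elements with
   associated map S are the g mu(w) with w even, and by Parseval their values |tr(Pi_+ g mu(w))|^2
   average to 1. As each value is 0 or K = |H|/2, the t-th powers average to K^(t-1). *)

theory Submission
  imports Defs "Jordan_Normal_Form.Determinant"
begin

section \<open>Adjoint, trace and unitary matrices\<close>

text \<open>The obstacle is that an associated map is a bare function: its additivity is not part of
  the definition, so neither closure of H under addition nor multiplicativity of ch can be read off
  from S. Instead ch(v) is defined for every even v as a normalised trace. Where a scaling relation
  holds, this trace returns the scalar; scaling relations multiply because conjugation does; off H
  the trace vanishes. So H is exactly the set of even v with ch(v) nonzero, and closure follows
  since a product of nonzero scalars is nonzero. The shift by j enters through J = mu(j): as Pi_+ J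
  = Pi_+, the operators mu(v) and mu(v + j) agree up to a phase after multiplication by Pi_+, so v +
  j counts like v. Evenness has one source as well: J passes mu(v) with the sign (-1)^|v|. That sign
  cuts the twirl down to even v, kills the odd Parseval terms and excludes odd w from the classes
  over S. The average 1 arises because N tr(Pi_+) = N^2/2, with N = 2^n, is also the number of even
  vectors.\<close>

lemma adj_carrier [simp]: "A \<in> carrier_mat N N \<Longrightarrow> adj A \<in> carrier_mat N N"
  by (auto simp: adj_def)

lemma adj_index: "A \<in> carrier_mat N N \<Longrightarrow> i < N \<Longrightarrow> k < N \<Longrightarrow> adj A $$ (i,k) = cnj (A $$ (k,i))"
  by (auto simp: adj_def)

lemma adj_adj: "A \<in> carrier_mat N N \<Longrightarrow> adj (adj A) = A"
  by (auto simp: adj_def)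

lemma adj_smult: "A \<in> carrier_mat N N \<Longrightarrow> adj (c \<cdot>\<^sub>m A) = cnj c \<cdot>\<^sub>m adj A"
  by (auto simp: adj_def)

lemma adj_one: "adj (1\<^sub>m N) = 1\<^sub>m N"
  by (auto simp: adj_def)

lemma adj_add:
  "A \<in> carrier_mat N N \<Longrightarrow> B \<in> carrier_mat N N \<Longrightarrow> adj (A + B) = adj A + adj B"
  by (auto simp: adj_def)

lemma mult_index:
  assumes "A \<in> carrier_mat N N" "B \<in> carrier_mat N N" "i < N" "k < N"
  shows "(A * B) $$ (i,k) = (\<Sum>l<N. A $$ (i,l) * B $$ (l,k))"
  using assms by (auto simp: scalar_prod_def atLeast0LessThan intro!: sum.cong)

lemma adj_mult:
  assumes "A \<in> carrier_mat N N" "B \<in> carrier_mat N N"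
  shows "adj (A * B) = adj B * adj A"
proof (rule eq_matI)
  fix i k assume "i < dim_row (adj B * adj A)" "k < dim_col (adj B * adj A)"
  with assms have ik: "i < N" "k < N" by (auto simp: adj_def)
  have "adj (A * B) $$ (i,k) = cnj ((A * B) $$ (k,i))"
    using ik assms by (intro adj_index[of _ N]) auto
  also have "\<dots> = (adj B * adj A) $$ (i,k)"
    unfolding mult_index[OF assms ik(2,1)] mult_index[OF adj_carrier[OF assms(2)] adj_carrier[OF assms(1)] ik]
    by (simp add: cnj_sum adj_index[OF assms(1) ] adj_index[OF assms(2)] ik mult.commute)
  finally show "adj (A * B) $$ (i,k) = (adj B * adj A) $$ (i,k)" .
qed (use assms in \<open>auto simp: adj_def\<close>)

lemma mtrace_carrier: "A \<in> carrier_mat N N \<Longrightarrow> mtrace A = (\<Sum>i<N. A $$ (i,i))"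
  by (auto simp: mtrace_def)

lemma mtrace_mult:
  assumes "A \<in> carrier_mat N N" "B \<in> carrier_mat N N"
  shows "mtrace (A * B) = (\<Sum>i<N. \<Sum>k<N. A $$ (i,k) * B $$ (k,i))"
  using assms by (simp add: mtrace_carrier[of _ N] mult_index[of _ N] del: index_mult_mat)

lemma mtrace_mult_comm:
  assumes "A \<in> carrier_mat N N" "B \<in> carrier_mat N N"
  shows "mtrace (A * B) = mtrace (B * A)"
  unfolding mtrace_mult[OF assms] mtrace_mult[OF assms(2,1)]
  by (subst sum.swap) (simp add: mult.commute)

lemma mtrace_smult: "A \<in> carrier_mat N N \<Longrightarrow> mtrace (c \<cdot>\<^sub>m A) = c * mtrace A"
  by (auto simp: mtrace_def sum_distrib_left)

lemma mtrace_add: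
  "A \<in> carrier_mat N N \<Longrightarrow> B \<in> carrier_mat N N \<Longrightarrow> mtrace (A + B) = mtrace A + mtrace B"
  by (auto simp: mtrace_def sum.distrib)

lemma mtrace_one: "mtrace (1\<^sub>m N) = of_nat N"
  by (simp add: mtrace_def)

lemma mtrace_adj: "A \<in> carrier_mat N N \<Longrightarrow> mtrace (adj A) = cnj (mtrace A)"
  by (auto simp: mtrace_carrier[of _ N] adj_index[of _ N])

lemma unitary_mult:
  assumes "unitary_mat N U" "unitary_mat N V"
  shows "unitary_mat N (U * V)"
proof -
  have c: "U \<in> carrier_mat N N" "V \<in> carrier_mat N N"
    using assms by (auto simp: unitary_mat_def)
  have ac: "A * B * C = A * (B * C)"
    if "A \<in> carrier_mat N N" "B \<in> carrier_mat N N" "C \<in> carrier_mat N N" for A B C :: "complex mat"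
    using that by (rule assoc_mult_mat)
  have "U * V * (adj V * adj U) = U * (V * adj V) * adj U"
    using c by (simp add: ac mult_carrier_mat[of _ N N])
  moreover have "adj V * adj U * (U * V) = adj V * (adj U * U) * V"
    using c by (simp add: ac mult_carrier_mat[of _ N N])
  ultimately show ?thesis
    using c assms by (auto simp: unitary_mat_def adj_mult[of _ N] right_mult_one_mat[of _ N N])
qed

lemma unitary_adj: "unitary_mat N U \<Longrightarrow> unitary_mat N (adj U)"
  by (auto simp: unitary_mat_def adj_adj[of _ N])

lemma unitary_one: "unitary_mat N (1\<^sub>m N)"
  by (auto simp: unitary_mat_def adj_one)

lemma smult_smult_mat: "a \<cdot>\<^sub>m (b \<cdot>\<^sub>m A) = (a * b) \<cdot>\<^sub>m (A :: 'a::semigroup_mult mat)"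
  by (rule eq_matI) (auto simp: mult.assoc)

lemma one_smult_mat: "1 \<cdot>\<^sub>m A = (A :: 'a::monoid_mult mat)"
  by (rule eq_matI) auto

lemma unitary_smult:
  assumes "unitary_mat N U" "cmod z = 1"
  shows "unitary_mat N (z \<cdot>\<^sub>m U)"
proof -
  have z: "z * cnj z = 1" "cnj z * z = 1"
    using assms(2) by (simp_all add: complex_norm_square[symmetric] mult.commute)
  show ?thesis
    using assms(1) z
    by (auto simp: unitary_mat_def adj_smult[of _ N] mult_smult_distrib[of _ N N _ N]
        mult_smult_assoc_mat[of _ N N _ N] smult_smult_mat one_smult_mat)
qed

section \<open>Completeness of orthogonal matrix bases\<close>

lemma mult_add_less_square:
  fixes a b N :: nat
  assumes "a < N" "b < N"
  shows "a * N + b < N * N"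
proof -
  have "a * N + b < Suc a * N" using assms by simp
  also have "\<dots> \<le> N * N" using assms by (intro mult_le_mono) auto
  finally show ?thesis .
qed

lemma sum_pairs_mult:
  fixes g :: "nat \<Rightarrow> nat \<Rightarrow> 'a::comm_monoid_add"
  shows "(\<Sum>s<N*N. g (s div N) (s mod N)) = (\<Sum>a<N. \<Sum>b<N. g a b)"
proof -
  have "(\<Sum>a<N. \<Sum>b<N. g a b) = (\<Sum>p\<in>{..<N}\<times>{..<N}. g (fst p) (snd p))"
    by (simp add: sum.cartesian_product case_prod_beta)
  also have "\<dots> = (\<Sum>s<N*N. g (s div N) (s mod N))"
    by (cases "N = 0", simp, rule sum.reindex_bij_witness[where j = "\<lambda>p. fst p * N + snd p" and i = "\<lambda>s. (s div N, s mod N)"])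
       (auto simp: less_mult_imp_div_less intro: mod_less_divisor mult_add_less_square)
  finally show ?thesis by simp
qed

text \<open>Orthogonality says that the \<open>N\<^sup>2 \<times> N\<^sup>2\<close> matrix whose rows are the flattened \<open>f v\<close> has a right
  inverse; completeness is the statement that this is also a left inverse.\<close>
lemma orthogonal_basis_completeness:
  fixes f :: "'i \<Rightarrow> complex mat"
  assumes I: "finite I" "card I = N * N"
    and f: "\<And>v. v \<in> I \<Longrightarrow> f v \<in> carrier_mat N N"
    and orth: "\<And>v w. v \<in> I \<Longrightarrow> w \<in> I \<Longrightarrow> mtrace (f v * adj (f w)) = (if v = w then of_nat N else 0)"
    and lt: "a < N" "b < N" "c < N" "d < N"
  shows "(\<Sum>v\<in>I. f v $$ (a,b) * cnj (f v $$ (c,d))) = (if a = c \<and> b = d then of_nat N else 0)"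
proof -
  obtain e where e: "bij_betw e {..<N*N} I"
    using I ex_bij_betw_nat_finite[of I] by (auto simp: atLeast0LessThan)
  have eI: "e r \<in> I" if "r < N*N" for r
    using e that by (auto simp: bij_betw_def)
  have N: "N > 0" using lt by simp
  define B where "B = mat (N*N) (N*N) (\<lambda>(r,s). f (e r) $$ (s div N, s mod N))"
  define C where "C = (1 / of_nat N :: complex) \<cdot>\<^sub>m adj B"
  have Bc: "B \<in> carrier_mat (N*N) (N*N)" by (simp add: B_def)
  hence Cc: "C \<in> carrier_mat (N*N) (N*N)" by (simp add: C_def)
  have Ci: "C $$ (s,r) = cnj (f (e r) $$ (s div N, s mod N)) / of_nat N" if "r < N*N" "s < N*N" for r s
    using that Bc by (simp add: C_def adj_def B_def)
  have "B * C = 1\<^sub>m (N*N)"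
  proof (rule eq_matI)
    fix r q assume "r < dim_row (1\<^sub>m (N*N))" "q < dim_col (1\<^sub>m (N*N))"
    hence rq: "r < N*N" "q < N*N" by auto
    have "(B * C) $$ (r,q) = (\<Sum>s<N*N. f (e r) $$ (s div N, s mod N) * (cnj (f (e q) $$ (s div N, s mod N)) / of_nat N))"
      using rq by (subst mult_index[OF Bc Cc]) (auto simp: Ci B_def)
    also have "\<dots> = (\<Sum>a<N. \<Sum>b<N. f (e r) $$ (a,b) * (cnj (f (e q) $$ (a,b)) / of_nat N))"
      by (rule sum_pairs_mult)
    also have "\<dots> = mtrace (f (e r) * adj (f (e q))) / of_nat N"
      using f[OF eI[OF rq(1)]] f[OF eI[OF rq(2)]]
      by (simp add: mtrace_mult[of _ N] adj_index[of _ N] sum_divide_distrib)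
    also have "\<dots> = (if r = q then 1 else 0)"
      using orth[OF eI[OF rq(1)] eI[OF rq(2)]] N e rq 
      by (auto simp: bij_betw_def inj_on_def)
    finally show "(B * C) $$ (r,q) = 1\<^sub>m (N*N) $$ (r,q)" using rq by simp
  qed (use Bc Cc in auto)
  hence CB: "C * B = 1\<^sub>m (N*N)"
    by (rule mat_mult_left_right_inverse[OF Bc Cc])
  \<comment> \<open>The positions \<open>(c,d)\<close> and \<open>(a,b)\<close> in flattened form:
    entry \<open>(s,q)\<close> of \<open>C * B\<close> is the required sum divided by
    \<open>N\<close>.\<close>
  define s q where "s = c * N + d" and "q = a * N + b"
  have sq: "s < N*N" "q < N*N" "s div N = c" "s mod N = d" "q div N = a" "q mod N = b"
    using lt by (auto simp: s_def q_def intro: mult_add_less_square)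
  have "(\<Sum>v\<in>I. f v $$ (a,b) * cnj (f v $$ (c,d))) = (\<Sum>r<N*N. f (e r) $$ (a,b) * cnj (f (e r) $$ (c,d)))"
    by (rule sum.reindex_bij_betw[OF e, symmetric])
  also have "\<dots> = of_nat N * (C * B) $$ (s,q)"
    using sq N by (subst mult_index[OF Cc Bc]) (auto simp: Ci B_def sum_distrib_left mult.commute intro!: sum.cong)
  also have "\<dots> = (if s = q then of_nat N else 0)"
    using sq by (simp add: CB)
  also have "(s = q) = (a = c \<and> b = d)"
    using sq by (metis s_def q_def)
  finally show ?thesis .
qed

section \<open>Majorana operators\<close>

lemma vadd_iff: "x \<in> vadd v w \<longleftrightarrow> (x \<in> v) \<noteq> (x \<in> w)"
  by (auto simp: vadd_def)

lemma finite_F2vecs: "finite (F2vecs n)"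
  by (simp add: F2vecs_def)

lemma vadd_F2vecs: "v \<in> F2vecs n \<Longrightarrow> w \<in> F2vecs n \<Longrightarrow> vadd v w \<in> F2vecs n"
  by (auto simp: F2vecs_def vadd_def)

lemma even_card_vadd:
  assumes "finite v" "finite w"
  shows "even (card (vadd v w)) = even (card v + card w)"
proof -
  have "card (vadd v w) + 2 * card (v \<inter> w) = card v + card w"
  proof -
    have "card v = card (v - w) + card (v \<inter> w)"
      using assms by (subst card_Un_disjoint[symmetric]) (auto intro: arg_cong[where f = card])
    moreover have "card w = card (w - v) + card (v \<inter> w)"
      using assms by (subst card_Un_disjoint[symmetric]) (auto intro: arg_cong[where f = card])
    moreover have "card (vadd v w) = card (v - w) + card (w - v)"
      unfolding vadd_def using assms by (subst card_Un_disjoint) auto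
    ultimately show ?thesis by simp
  qed
  thus ?thesis by (metis even_add even_mult_iff even_numeral)
qed

lemma vadd_even: "v \<in> F2vecs_even n \<Longrightarrow> w \<in> F2vecs_even n \<Longrightarrow> vadd v w \<in> F2vecs_even n"
  using vadd_F2vecs[of v n w] even_card_vadd[of v w]
  by (auto simp: F2vecs_even_def F2vecs_def finite_subset[of _ "{0..<2*n}"])

lemma vadd_self [simp]: "vadd v v = {}"
  by (auto simp: vadd_def)

lemma vadd_empty [simp]: "vadd v {} = v" "vadd {} v = v"
  by (auto simp: vadd_def)

lemma vadd_commute: "vadd v w = vadd w v"
  by (auto simp: vadd_def)

lemma vadd_assoc: "vadd (vadd u v) w = vadd u (vadd v w)"
  by (auto simp: vadd_iff)

lemma vadd_left_cancel: "vadd u v = vadd u w \<longleftrightarrow> v = w"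
  by (metis vadd_assoc vadd_self vadd_empty(2))

lemma vadd_eq_iff: "vadd u v = w \<longleftrightarrow> u = vadd w v"
  by (metis vadd_assoc vadd_self vadd_empty(1))

locale majorana =
  fixes n :: nat and chi :: "nat \<Rightarrow> complex mat"
  assumes n_pos: "n \<ge> 1" and family: "majorana_family n chi"
begin

abbreviation "N \<equiv> (2::nat) ^ n"
abbreviation "M \<equiv> carrier_mat N N :: complex mat set"

lemma mult_M [simp]: "A \<in> M \<Longrightarrow> B \<in> M \<Longrightarrow> A * B \<in> M"
  by simp
lemma assoc_M: "A \<in> M \<Longrightarrow> B \<in> M \<Longrightarrow> C \<in> M \<Longrightarrow> A * B * C = A * (B * C)"
  by (rule assoc_mult_mat)
lemma smult_left_M: "A \<in> M \<Longrightarrow> B \<in> M \<Longrightarrow> (c \<cdot>\<^sub>m A) * B = c \<cdot>\<^sub>m (A * B)"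
  by (rule mult_smult_assoc_mat)
lemma smult_right_M: "A \<in> M \<Longrightarrow> B \<in> M \<Longrightarrow> A * (c \<cdot>\<^sub>m B) = c \<cdot>\<^sub>m (A * B)"
  by (rule mult_smult_distrib)
lemma one_M [simp]: "A \<in> M \<Longrightarrow> 1\<^sub>m N * A = A" "A \<in> M \<Longrightarrow> A * 1\<^sub>m N = A"
  by auto
lemma unitary_M: "unitary_mat N U \<Longrightarrow> U \<in> M"
  by (simp add: unitary_mat_def)
lemma unitary_cancel:
  assumes "unitary_mat N U"
  shows "U * adj U = 1\<^sub>m N" "adj U * U = 1\<^sub>m N"
    "A \<in> M \<Longrightarrow> U * (adj U * A) = A" "A \<in> M \<Longrightarrow> adj U * (U * A) = A"
  using assms by (auto simp: unitary_mat_def assoc_M[symmetric])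

lemmas mat_alg = assoc_M smult_left_M smult_right_M smult_smult_mat one_smult_mat

lemma smult_cancel: "c \<cdot>\<^sub>m A = B \<Longrightarrow> c \<noteq> 0 \<Longrightarrow> A = (1/c) \<cdot>\<^sub>m (B :: complex mat)"
  by (auto simp: smult_smult_mat one_smult_mat)

lemma chi_M [simp]: "i < 2*n \<Longrightarrow> chi i \<in> M"
  and chi_adj: "i < 2*n \<Longrightarrow> adj (chi i) = chi i"
  using family by (auto simp: majorana_family_def)

lemma chi_square: assumes "i < 2*n" shows "chi i * chi i = 1\<^sub>m N"
proof -
  have *: "chi i * chi i + chi i * chi i = 2 \<cdot>\<^sub>m 1\<^sub>m N"
    using family assms by (auto simp: majorana_family_def)
  show ?thesis
  proof (rule eq_matI)
    fix a b assume ab: "a < dim_row (1\<^sub>m N)" "b < dim_col (1\<^sub>m N)"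
    have "(chi i * chi i + chi i * chi i) $$ (a,b) = 2 * (chi i * chi i) $$ (a,b)"
      using ab chi_M[OF assms] by (subst index_add_mat) auto
    thus "(chi i * chi i) $$ (a,b) = 1\<^sub>m N $$ (a,b)"
      unfolding * using ab by simp
  qed (use chi_M[OF assms] in auto)
qed

lemma chi_anticommute: assumes "i < 2*n" "k < 2*n" "i \<noteq> k" shows "chi i * chi k = (-1) \<cdot>\<^sub>m (chi k * chi i)"
proof -
  have *: "chi i * chi k + chi k * chi i = 0\<^sub>m N N"
    using family assms by (auto simp: majorana_family_def)
  show ?thesis
  proof (rule eq_matI)
    fix a b assume ab: "a < dim_row ((-1) \<cdot>\<^sub>m (chi k * chi i))" "b < dim_col ((-1) \<cdot>\<^sub>m (chi k * chi i))"
    hence "(chi i * chi k + chi k * chi i) $$ (a,b) = (chi i * chi k) $$ (a,b) + (chi k * chi i) $$ (a,b)"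
      by (subst index_add_mat) auto
    thus "(chi i * chi k) $$ (a,b) = ((-1) \<cdot>\<^sub>m (chi k * chi i)) $$ (a,b)"
      unfolding * using ab chi_M[OF assms(1)] chi_M[OF assms(2)] by (auto simp del: index_mult_mat(1) simp: eq_neg_iff_add_eq_0)
  qed (use chi_M[OF assms(1)] chi_M[OF assms(2)] in auto)
qed

lemma chi_unitary: "i < 2*n \<Longrightarrow> unitary_mat N (chi i)"
  by (simp add: unitary_mat_def chi_adj chi_square)

section \<open>Ordered products of the generators along a list\<close>

definition cprod :: "nat list \<Rightarrow> nat set \<Rightarrow> complex mat" where
  "cprod L v = foldr (\<lambda>k A. (if k \<in> v then chi k else 1\<^sub>m N) * A) L (1\<^sub>m N)"

lemma cprod_Nil [simp]: "cprod [] v = 1\<^sub>m N"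
  by (simp add: cprod_def)

lemma cprod_Cons: "cprod (a # L) v = (if a \<in> v then chi a else 1\<^sub>m N) * cprod L v"
  by (simp add: cprod_def)

lemma cprod_unitary: "set L \<subseteq> {..<2*n} \<Longrightarrow> unitary_mat N (cprod L v)"
  by (induction L) (auto simp: cprod_Cons unitary_one intro!: unitary_mult chi_unitary)

lemma cprod_M [simp]: "set L \<subseteq> {..<2*n} \<Longrightarrow> cprod L v \<in> M"
  using cprod_unitary unitary_M by blast

lemma cprod_Cons': "set (a#L) \<subseteq> {..<2*n} \<Longrightarrow> cprod (a # L) v = (if a \<in> v then chi a * cprod L v else cprod L v)"
  by (auto simp: cprod_Cons)

lemma cprod_cong: "v \<inter> set L = w \<inter> set L \<Longrightarrow> cprod L v = cprod L w"
proof (induction L)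
  case (Cons a L)
  hence "v \<inter> set L = w \<inter> set L" "a \<in> v \<longleftrightarrow> a \<in> w" by auto
  thus ?case using Cons.IH by (simp add: cprod_Cons)
qed auto

text \<open>On its way through the product, \<open>chi k\<close> picks up a sign from every factor
  \<open>chi i\<close> with \<open>i \<noteq> k\<close> and none from itself; hence
  \<open>{k}\<close> is removed from the count.\<close>

lemma chi_commute_cprod:
  assumes "distinct L" "set L \<subseteq> {..<2*n}" "k < 2*n"
  shows "chi k * cprod L v = ((-1) ^ card (v \<inter> set L - {k})) \<cdot>\<^sub>m (cprod L v * chi k)"
  using assms
proof (induction L)
  case (Cons a L)
  hence IH: "chi k * cprod L v = ((-1) ^ card (v \<inter> set L - {k})) \<cdot>\<^sub>m (cprod L v * chi k)"
    and L: "set L \<subseteq> {..<2*n}" "a < 2*n" "a \<notin> set L" by auto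
  note cM = cprod_M[OF L(1), of v] chi_M[OF L(2)] chi_M[OF Cons.prems(3)]
  consider "a \<notin> v" | "a \<in> v" "a = k" | "a \<in> v" "a \<noteq> k" by blast
  thus ?case
  proof cases
    case 1
    thus ?thesis using IH Cons.prems by (simp add: cprod_Cons')
  next
    case 2
    have "chi k * cprod (a # L) v = chi k * (chi k * cprod L v)"
      using 2 Cons.prems by (simp add: cprod_Cons')
    also have "\<dots> = ((-1) ^ card (v \<inter> set L - {k})) \<cdot>\<^sub>m (chi k * (cprod L v * chi k))"
      using cM IH by (simp add: smult_right_M mult_carrier_mat[of _ N N])
    also have "\<dots> = ((-1) ^ card (v \<inter> set (a # L) - {k})) \<cdot>\<^sub>m (cprod (a # L) v * chi k)"
      using 2 Cons.prems cM by (simp add: cprod_Cons' assoc_M Int_insert_right)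
    finally show ?thesis .
  next
    case 3
    have card: "card (v \<inter> set (a # L) - {k}) = Suc (card (v \<inter> set L - {k}))"
      using 3 L by (subst card_Suc_eq_finite) (auto intro!: exI[of _ a] exI[of _ "v \<inter> set L - {k}"])
    have "chi k * cprod (a # L) v = (chi k * chi a) * cprod L v"
      using 3 Cons.prems cM by (simp add: cprod_Cons' assoc_M)
    also have "\<dots> = (-1) \<cdot>\<^sub>m (chi a * (chi k * cprod L v))"
      using 3 L Cons.prems cM chi_anticommute[of k a] by (simp add: mat_alg mult_carrier_mat[of _ N N])
    also have "\<dots> = (- ((-1) ^ card (v \<inter> set L - {k}))) \<cdot>\<^sub>m (chi a * (cprod L v * chi k))"
      using cM IH by (simp add: mat_alg mult_carrier_mat[of _ N N])
    also have "\<dots> = ((-1) ^ card (v \<inter> set (a # L) - {k})) \<cdot>\<^sub>m (cprod (a # L) v * chi k)"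
      unfolding card using 3 Cons.prems cM by (simp add: cprod_Cons' assoc_M)
    finally show ?thesis .
  qed
qed auto

text \<open>\<open>chi k\<close> travels with signs to its own slot in \<open>L\<close>, where it
  either cancels an equal factor or fills the gap.\<close>

lemma chi_mult_cprod:
  assumes "distinct L" "set L \<subseteq> {..<2*n}" "k \<in> set L"
  shows "\<exists>s. cmod s = 1 \<and> chi k * cprod L v = s \<cdot>\<^sub>m cprod L (vadd v {k})"
  using assms
proof (induction L)
  case (Cons a L)
  hence L: "set L \<subseteq> {..<2*n}" "a < 2*n" "a \<notin> set L" "k < 2*n" by auto
  note cM = cprod_M[OF L(1), of v] chi_M[OF L(2)] chi_M[OF L(4)]
  show ?case
  proof (cases "a = k")
    case True
    have "cprod L (vadd v {k}) = cprod L v"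
      using True L by (intro cprod_cong) (auto simp: vadd_iff)
    thus ?thesis using True Cons.prems cM L
      by (intro exI[of _ 1]) (auto simp: cprod_Cons' vadd_iff one_smult_mat assoc_M[symmetric] chi_square)
  next
    case False
    then obtain s where s: "cmod s = 1" "chi k * cprod L v = s \<cdot>\<^sub>m cprod L (vadd v {k})"
      using Cons by auto
    show ?thesis
    proof (cases "a \<in> v")
      case True
      have "chi k * cprod (a # L) v = (chi k * chi a) * cprod L v"
        using True Cons.prems cM by (simp add: cprod_Cons' assoc_M)
      also have "\<dots> = (-1) \<cdot>\<^sub>m (chi a * (chi k * cprod L v))"
        using False L Cons.prems cM chi_anticommute[of k a] by (simp add: mat_alg mult_carrier_mat[of _ N N])
      also have "\<dots> = (-s) \<cdot>\<^sub>m cprod (a # L) (vadd v {k})"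
        using True False Cons.prems cM s L by (simp add: cprod_Cons' mat_alg vadd_iff)
      finally show ?thesis using s by (intro exI[of _ "-s"]) auto
    next
      case a: False
      thus ?thesis using s False Cons.prems by (auto simp: cprod_Cons' vadd_iff)
    qed
  qed
qed auto

text \<open>Two lists make the induction possible: the left product is absorbed letter by letter,
  while the right one stays ordered along all of \<open>L\<close>. The set
  \<open>v \<inter> set K\<close> records the letters absorbed so far.\<close>

lemma cprod_mult:
  assumes "distinct K" "distinct L" "set L \<subseteq> {..<2*n}" "set K \<subseteq> set L"
  shows "\<exists>s. cmod s = 1 \<and> cprod K v * cprod L w = s \<cdot>\<^sub>m cprod L (vadd (v \<inter> set K) w)"
  using assms
proof (induction K)
  case Nil
  thus ?case by (intro exI[of _ 1]) (auto simp: one_smult_mat)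
next
  case (Cons a K)
  then obtain s where s: "cmod s = 1" "cprod K v * cprod L w = s \<cdot>\<^sub>m cprod L (vadd (v \<inter> set K) w)"
    by auto
  have K: "set (a # K) \<subseteq> {..<2*n}" "set K \<subseteq> {..<2*n}" "a < 2*n" "a \<notin> set K" using Cons.prems by auto
  note cM = cprod_M[OF K(2), of v] cprod_M[OF Cons.prems(3)] chi_M[OF K(3)]
  show ?case
  proof (cases "a \<in> v")
    case True
    obtain r where r: "cmod r = 1" "chi a * cprod L (vadd (v \<inter> set K) w)
        = r \<cdot>\<^sub>m cprod L (vadd (vadd (v \<inter> set K) w) {a})"
      using chi_mult_cprod[of L a "vadd (v \<inter> set K) w"] Cons.prems by auto
    have "vadd (vadd (v \<inter> set K) w) {a} = vadd (v \<inter> set (a # K)) w"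
      using True K by (auto simp: vadd_iff)
    hence "cprod (a # K) v * cprod L w = (s * r) \<cdot>\<^sub>m cprod L (vadd (v \<inter> set (a # K)) w)"
      using True cM s r by (simp add: cprod_Cons'[OF K(1)] mat_alg)
    thus ?thesis using s r by (intro exI[of _ "s * r"]) (auto simp: norm_mult)
  next
    case False
    thus ?thesis using s by (auto simp: cprod_Cons'[OF K(1)] Int_insert_right)
  qed
qed

lemma upt_subset [simp]: "{0..<2*n} \<subseteq> {..<2*n}"
  by auto

section \<open>Products up to phase and trace orthogonality of the operators \<mu> v\<close>

abbreviation mu' :: "nat set \<Rightarrow> complex mat" ("\<mu>") where "mu' \<equiv> mu n chi"

lemma mu_cprod: "\<mu> v = (\<i> ^ omegaL_form v) \<cdot>\<^sub>m cprod [0..<2*n] v"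
  by (simp add: mu_def chi_prod_def cprod_def)

lemma mu_unitary: "unitary_mat N (\<mu> v)"
  unfolding mu_cprod by (intro unitary_smult cprod_unitary) (auto simp: norm_power)

lemma mu_M [simp]: "\<mu> v \<in> M" by (rule unitary_M[OF mu_unitary])

lemma mu_empty: "\<mu> {} = 1\<^sub>m N"
proof -
  have "set L \<subseteq> {..<2*n} \<Longrightarrow> cprod L {} = 1\<^sub>m N" for L
    by (induction L) (auto simp: cprod_Cons')
  from this[of "[0..<2*n]"] show ?thesis
    unfolding mu_cprod by (auto simp: omegaL_form_def one_smult_mat)
qed

text \<open>A projective representation of the binary vectors. Its cocycle stays existential, since
  later arguments use only that it is a unimodular scalar.\<close>

lemma mu_mult:
  assumes "v \<in> F2vecs n"
  shows "\<exists>s. cmod s = 1 \<and> \<mu> v * \<mu> w = s \<cdot>\<^sub>m \<mu> (vadd v w)"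
proof -
  obtain s where s: "cmod s = 1" "cprod [0..<2*n] v * cprod [0..<2*n] w
      = s \<cdot>\<^sub>m cprod [0..<2*n] (vadd (v \<inter> set [0..<2*n]) w)"
    using cprod_mult[of "[0..<2*n]" "[0..<2*n]" v w] by auto
  moreover have "v \<inter> set [0..<2*n] = v" using assms by (auto simp: F2vecs_def)
  ultimately have s2: "cprod [0..<2*n] v * cprod [0..<2*n] w = s \<cdot>\<^sub>m cprod [0..<2*n] (vadd v w)" by simp
  define z where "z = \<i> ^ omegaL_form w * \<i> ^ omegaL_form v * s"
  have "\<mu> v * \<mu> w = z \<cdot>\<^sub>m cprod [0..<2*n] (vadd v w)"
    unfolding mu_cprod z_def by (simp add: smult_left_M smult_right_M smult_smult_mat s2 mult.assoc)
  also have "\<dots> = (z / \<i> ^ omegaL_form (vadd v w)) \<cdot>\<^sub>m \<mu> (vadd v w)"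
    by (simp add: mu_cprod smult_smult_mat z_def mult.assoc)
  finally show ?thesis
    by (intro exI[of _ "z / \<i> ^ omegaL_form (vadd v w)"])
       (simp add: z_def s(1) norm_mult norm_divide norm_power)
qed

lemma mu_commute:
  assumes "v \<in> F2vecs n" "w \<in> F2vecs n"
  shows "\<exists>s. cmod s = 1 \<and> \<mu> v * \<mu> w = s \<cdot>\<^sub>m (\<mu> w * \<mu> v)"
proof -
  obtain s where s: "cmod s = 1" "\<mu> v * \<mu> w = s \<cdot>\<^sub>m \<mu> (vadd v w)"
    using mu_mult[OF assms(1)] by blast
  obtain r where r: "cmod r = 1" "\<mu> w * \<mu> v = r \<cdot>\<^sub>m \<mu> (vadd w v)"
    using mu_mult[OF assms(2)] by blast
  have "\<mu> v * \<mu> w = (s / r) \<cdot>\<^sub>m (\<mu> w * \<mu> v)"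
    using r(1) s(2) by (cases "r = 0") (auto simp: r(2) vadd_commute[of w] smult_smult_mat)
  thus ?thesis using s r by (intro exI[of _ "s/r"]) (auto simp: norm_divide)
qed

lemma chi_commute_mu:
  assumes "k < 2*n" "v \<in> F2vecs n"
  shows "chi k * \<mu> v = ((-1) ^ card (v - {k})) \<cdot>\<^sub>m (\<mu> v * chi k)"
proof -
  have "v \<inter> set [0..<2*n] = v" using assms by (auto simp: F2vecs_def)
  thus ?thesis
    using chi_commute_cprod[of "[0..<2*n]" k v] assms
    by (simp add: mu_cprod smult_left_M smult_right_M smult_smult_mat mult.commute[of "\<i> ^ _"])
qed

text \<open>For nonempty \<open>v\<close> some \<open>chi k\<close> anticommutes with
  \<open>\<mu> v\<close>: \<open>k\<close> is taken inside \<open>v\<close> for even weight and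
  outside for odd weight, where room is left because the full set has even size. Conjugation by this
  \<open>chi k\<close> keeps the trace and flips its sign.\<close>

lemma mtrace_mu:
  assumes "v \<in> F2vecs n"
  shows "mtrace (\<mu> v) = (if v = {} then of_nat N else 0)"
proof (cases "v = {}")
  case True
  thus ?thesis by (simp add: mu_empty mtrace_one)
next
  case False
  have v: "v \<subseteq> {0..<2*n}" "finite v" using assms by (auto simp: F2vecs_def finite_subset)
  obtain k where k: "k < 2*n" "odd (card (v - {k}))"
  proof (cases "even (card v)")
    case True
    from False obtain k where "k \<in> v" by blast
    thus ?thesis using that[of k] True v False by (auto simp: card_Diff_singleton card_gt_0_iff)
  next
    case odd: False
    hence "v \<noteq> {0..<2*n}" by auto
    then obtain k where "k < 2*n" "k \<notin> v" using v(1) by (metis atLeastLessThan_iff subsetI subset_antisym)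
    thus ?thesis using that[of k] odd by auto
  qed
  have eq: "chi k * \<mu> v = (-1) \<cdot>\<^sub>m (\<mu> v * chi k)"
    using chi_commute_mu[OF k(1) assms] k(2) by simp
  have "mtrace (\<mu> v) = mtrace (chi k * (chi k * \<mu> v))"
    using k by (simp add: assoc_M[symmetric] chi_square)
  also have "\<dots> = - mtrace (chi k * (\<mu> v * chi k))"
    unfolding eq using k by (simp add: smult_right_M mtrace_smult[of _ N] mult_carrier_mat[of _ N N])
  also have "mtrace (chi k * (\<mu> v * chi k)) = mtrace (\<mu> v * chi k * chi k)"
    using k by (intro mtrace_mult_comm[of _ N]) auto
  also have "\<dots> = mtrace (\<mu> v)"
    using k by (simp add: assoc_M chi_square)
  finally show ?thesis using False by simp
qed

text \<open>The product rule for \<open>vadd v w\<close> and \<open>w\<close> returns to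
  \<open>v\<close>; cancelling \<open>\<mu> w\<close> on the right gives the claim without computing
  the adjoint.\<close>

lemma mu_mult_adj:
  assumes "v \<in> F2vecs n" "w \<in> F2vecs n"
  shows "\<exists>s. cmod s = 1 \<and> \<mu> v * adj (\<mu> w) = s \<cdot>\<^sub>m \<mu> (vadd v w)"
proof -
  obtain s where s: "cmod s = 1" "\<mu> (vadd v w) * \<mu> w = s \<cdot>\<^sub>m \<mu> v"
    using mu_mult[of "vadd v w" w] assms by (auto simp: vadd_F2vecs vadd_assoc)
  have s0: "s \<noteq> 0" using s by auto
  have "\<mu> v = (1/s) \<cdot>\<^sub>m (\<mu> (vadd v w) * \<mu> w)"
    using s s0 by (simp add: smult_smult_mat one_smult_mat)
  hence "\<mu> v * adj (\<mu> w) = (1/s) \<cdot>\<^sub>m (\<mu> (vadd v w) * \<mu> w * adj (\<mu> w))"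
    by (simp add: smult_left_M)
  also have "\<dots> = (1/s) \<cdot>\<^sub>m \<mu> (vadd v w)"
    by (simp add: assoc_M unitary_cancel[OF mu_unitary])
  finally show ?thesis using s by (intro exI[of _ "1/s"]) (auto simp: norm_divide)
qed

lemma mu_orthogonal:
  assumes "v \<in> F2vecs n" "w \<in> F2vecs n"
  shows "mtrace (\<mu> v * adj (\<mu> w)) = (if v = w then of_nat N else 0)"
proof (cases "v = w")
  case True
  thus ?thesis by (simp add: unitary_cancel[OF mu_unitary] mtrace_one)
next
  case False
  hence "vadd v w \<noteq> {}" by (auto simp: vadd_def)
  thus ?thesis
    using mu_mult_adj[OF assms] False mtrace_mu[OF vadd_F2vecs[OF assms]] by (auto simp: mtrace_smult[of _ N])
qed

text \<open>Otherwise orthogonality would force the trace norm of \<open>\<mu> v\<close> to vanish.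
  This turns identities between operators into equalities of binary vectors.\<close>

lemma mu_eq_smult_imp_eq:
  assumes "v \<in> F2vecs n" "w \<in> F2vecs n" "\<mu> v = c \<cdot>\<^sub>m \<mu> w"
  shows "v = w"
proof (rule ccontr)
  assume "v \<noteq> w"
  hence "mtrace (\<mu> w * adj (\<mu> v)) = 0"
    using mu_orthogonal[OF assms(2,1)] by simp
  moreover have "mtrace (\<mu> v * adj (\<mu> v)) = c * mtrace (\<mu> w * adj (\<mu> v))"
    by (subst assms(3)) (simp add: smult_left_M mtrace_smult[of _ N] mult_carrier_mat[of _ N N])
  ultimately show False using mu_orthogonal[OF assms(1,1)] by simp
qed

lemma card_F2vecs: "card (F2vecs n) = N * N"
  by (simp add: F2vecs_def card_Pow mult_2 power_add)

lemma mu_complete: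
  assumes "a < N" "b < N" "c < N" "d < N"
  shows "(\<Sum>v\<in>F2vecs n. \<mu> v $$ (a,b) * cnj (\<mu> v $$ (c,d))) = (if a = c \<and> b = d then of_nat N else 0)"
  by (rule orthogonal_basis_completeness) (use assms in \<open>auto simp: finite_F2vecs card_F2vecs mu_orthogonal\<close>)

section \<open>Parity and twirling\<close>

abbreviation J :: "complex mat" where "J \<equiv> \<mu> (jvec n)"

lemma cprod_snoc: "set L \<subseteq> {..<2*n} \<Longrightarrow> k < 2*n \<Longrightarrow> k \<in> v \<Longrightarrow> cprod (L @ [k]) v = cprod L v * chi k"
  by (induction L) (auto simp: cprod_Cons assoc_M)

text \<open>In the square of a prefix, the last factor \<open>chi m\<close> has to pass
  \<open>m\<close> earlier ones before it meets its copy, at the cost of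
  \<open>(-1)^m\<close>.\<close>

lemma full_cprod_square:
  assumes "m \<le> 2*n"
  shows "cprod [0..<m] {0..<2*n} * cprod [0..<m] {0..<2*n} = ((-1) ^ (\<Sum>i<m. i)) \<cdot>\<^sub>m 1\<^sub>m N"
  using assms
proof (induction m)
  case 0
  show ?case by (simp add: one_smult_mat)
next
  case (Suc m)
  define P where "P = cprod [0..<m] {0..<2*n}"
  have m: "m < 2*n" "{0..<m} \<subseteq> {..<2*n}" using Suc.prems by auto
  have P: "P \<in> M" unfolding P_def by (rule cprod_M) (use Suc.prems in auto)
  have chi: "chi m \<in> M" using m by simp
  have "{0..<2*n} \<inter> {0..<m} - {m} = {0..<m}" using m by auto
  hence com: "chi m * P = ((-1) ^ m) \<cdot>\<^sub>m (P * chi m)"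
    using chi_commute_cprod[of "[0..<m]" m "{0..<2*n}"] m by (simp add: P_def)
  have "cprod [0..<Suc m] {0..<2*n} = P * chi m"
    using cprod_snoc[of "[0..<m]" m "{0..<2*n}"] m by (simp add: P_def)
  hence "cprod [0..<Suc m] {0..<2*n} * cprod [0..<Suc m] {0..<2*n} = P * ((chi m * P) * chi m)"
    using P chi by (simp add: assoc_M)
  also have "\<dots> = ((-1) ^ m) \<cdot>\<^sub>m (P * P)"
    unfolding com using P chi chi_square[OF m(1)] by (simp add: smult_left_M smult_right_M assoc_M)
  also have "\<dots> = ((-1) ^ (\<Sum>i<Suc m. i)) \<cdot>\<^sub>m 1\<^sub>m N"
    using Suc by (simp add: P_def smult_smult_mat power_add mult.commute)
  finally show ?case .
qed

lemma omegaL_form_jvec: "omegaL_form (jvec n) = (\<Sum>i<2*n. i) mod 2"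
proof -
  have "{(i,k). i \<in> jvec n \<and> k \<in> jvec n \<and> k < i} = (SIGMA i:{..<2*n}. {..<i})"
    by (auto simp: jvec_def)
  thus ?thesis by (simp add: omegaL_form_def)
qed

lemma J_square: "J * J = 1\<^sub>m N"
proof -
  let ?s = "\<Sum>i<2*n. i" and ?P = "cprod [0..<2*n] {0..<2*n}"
  have "J * J = (\<i> ^ (?s mod 2) * \<i> ^ (?s mod 2)) \<cdot>\<^sub>m (?P * ?P)"
    unfolding mu_cprod omegaL_form_jvec by (simp add: smult_left_M smult_right_M smult_smult_mat jvec_def)
  also have "\<dots> = ((\<i> ^ (?s mod 2))^2 * (-1) ^ ?s) \<cdot>\<^sub>m 1\<^sub>m N"
    by (subst full_cprod_square) (auto simp: smult_smult_mat power2_eq_square)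
  \<comment> \<open>The phase in \<open>\<mu>\<close> is chosen for this: its square is exactly the
    reordering sign, which depends only on the parity of \<open>?s\<close>.\<close>
  also have "(\<i> ^ (?s mod 2))^2 * (-1) ^ ?s = 1"
    by (cases "even ?s") (auto simp: odd_iff_mod_2_eq_one)
  finally show ?thesis by (simp add: one_smult_mat)
qed

lemma J_adj: "adj J = J"
proof -
  have "adj J * (J * J) = J" by (simp add: unitary_cancel[OF mu_unitary])
  thus ?thesis by (simp add: J_square)
qed

lemma jvec_F2 [simp]: "jvec n \<in> F2vecs n"
  by (simp add: F2vecs_def jvec_def)

lemma J_chi: assumes "k < 2*n" shows "J * chi k = (-1) \<cdot>\<^sub>m (chi k * J)"
proof -
  have "card (jvec n - {k}) = 2*n - 1" using assms by (simp add: jvec_def)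
  hence "odd (card (jvec n - {k}))" using assms by simp
  hence "chi k * J = (-1) \<cdot>\<^sub>m (J * chi k)"
    using chi_commute_mu[OF assms jvec_F2] by simp
  thus ?thesis using assms by (simp add: smult_smult_mat one_smult_mat)
qed

lemma J_cprod:
  assumes "distinct L" "set L \<subseteq> {..<2*n}"
  shows "J * cprod L v = ((-1) ^ card (v \<inter> set L)) \<cdot>\<^sub>m (cprod L v * J)"
  using assms
proof (induction L)
  case Nil
  show ?case by (simp add: one_smult_mat)
next
  case (Cons a L)
  hence L: "set L \<subseteq> {..<2*n}" "a < 2*n" "a \<notin> set L"
    and IH: "J * cprod L v = ((-1) ^ card (v \<inter> set L)) \<cdot>\<^sub>m (cprod L v * J)" by auto
  note cM = cprod_M[OF L(1), of v] chi_M[OF L(2)]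
  show ?case
  proof (cases "a \<in> v")
    case True
    have "J * cprod (a # L) v = (J * chi a) * cprod L v"
      using True Cons.prems cM by (simp add: cprod_Cons' assoc_M)
    also have "\<dots> = (-1) \<cdot>\<^sub>m (chi a * (J * cprod L v))"
      unfolding J_chi[OF L(2)] using cM by (simp add: smult_left_M assoc_M)
    also have "\<dots> = ((-1) ^ card (v \<inter> set (a # L))) \<cdot>\<^sub>m (cprod (a # L) v * J)"
      unfolding IH using cM True L Cons.prems
      by (simp add: cprod_Cons' smult_right_M smult_smult_mat assoc_M Int_insert_right)
    finally show ?thesis .
  next
    case False
    thus ?thesis using IH Cons.prems by (simp add: cprod_Cons' Int_insert_right)
  qed
qed

lemma J_mu:
  assumes "v \<in> F2vecs n"
  shows "J * \<mu> v = ((-1) ^ card v) \<cdot>\<^sub>m (\<mu> v * J)"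
proof -
  have "v \<inter> set [0..<2*n] = v" using assms by (auto simp: F2vecs_def)
  hence "J * cprod [0..<2*n] v = ((-1) ^ card v) \<cdot>\<^sub>m (cprod [0..<2*n] v * J)"
    using J_cprod[of "[0..<2*n]" v] by simp
  thus ?thesis
    by (simp add: mu_cprod[of v] smult_left_M smult_right_M smult_smult_mat mult.commute[of "\<i> ^ _"])
qed

lemma even_F2: "v \<in> F2vecs_even n \<Longrightarrow> v \<in> F2vecs n"
  by (simp add: F2vecs_even_def)

lemma J_mu_even: "v \<in> F2vecs_even n \<Longrightarrow> J * \<mu> v = \<mu> v * J"
  using J_mu[of v] by (simp add: F2vecs_even_def one_smult_mat)

abbreviation even_proj :: "complex mat" where "even_proj \<equiv> Pi_plus n chi"

lemma Pi_M [simp]: "even_proj \<in> M"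
  by (simp add: Pi_plus_def)

lemma add_left_M: "A \<in> M \<Longrightarrow> B \<in> M \<Longrightarrow> C \<in> M \<Longrightarrow> (A + B) * C = A * C + B * C"
  by (rule add_mult_distrib_mat)

lemma add_right_M: "A \<in> M \<Longrightarrow> B \<in> M \<Longrightarrow> C \<in> M \<Longrightarrow> C * (A + B) = C * A + C * B"
  by (rule mult_add_distrib_mat)

lemma Pi_mult: "A \<in> M \<Longrightarrow> even_proj * A = (1/2) \<cdot>\<^sub>m (A + J * A)"
  by (simp add: Pi_plus_def smult_left_M add_left_M)

lemma mult_Pi: "A \<in> M \<Longrightarrow> A * even_proj = (1/2) \<cdot>\<^sub>m (A + A * J)"
  by (simp add: Pi_plus_def smult_right_M add_right_M)

text \<open>On the range of the projector \<open>J\<close> acts as the identity. This identifies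
  \<open>\<mu> v\<close> with its shift by \<open>jvec n\<close> up to a phase and is the source of
  \<open>c_plus\<close>.\<close>

lemma Pi_J: "even_proj * J = even_proj"
  unfolding Pi_mult[OF mu_M] J_square
  by (simp add: Pi_plus_def comm_add_mat[of J N N])

lemma Pi_commute: "A \<in> M \<Longrightarrow> A * J = J * A \<Longrightarrow> even_proj * A = A * even_proj"
  by (simp add: Pi_mult mult_Pi)

lemma Pi_adj: "adj even_proj = even_proj"
  by (simp add: Pi_plus_def adj_smult[of _ N] adj_add[of _ N] adj_one J_adj)

lemma Pi_idem: "even_proj * even_proj = even_proj"
proof -
  have "J * even_proj = even_proj" using Pi_commute[OF mu_M refl] Pi_J by simp
  hence "even_proj * even_proj = (1/2) \<cdot>\<^sub>m (even_proj + even_proj)" by (simp add: Pi_mult)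
  also have "\<dots> = even_proj"
    using carrier_matD[OF Pi_M] by (intro eq_matI) auto
  finally show ?thesis .
qed

lemma mtrace_Pi_mult: "A \<in> M \<Longrightarrow> mtrace (even_proj * A) = (mtrace A + mtrace (J * A)) / 2"
  by (simp add: Pi_mult mtrace_smult[of _ N] mtrace_add[of _ N])

lemma jvec_nonempty: "jvec n \<noteq> {}"
  using n_pos by (auto simp: jvec_def)

lemma mtrace_Pi: "mtrace even_proj = of_nat N / 2"
  using mtrace_Pi_mult[of "1\<^sub>m N"] jvec_nonempty by (simp add: mtrace_one mtrace_mu)

section \<open>The twirl, the Parseval identity and their restriction to even weight\<close>

lemma twirl_entry:
  assumes A: "A \<in> M" and il: "i < N" "l < N"
  shows "(\<Sum>v\<in>F2vecs n. (\<mu> v * A * adj (\<mu> v)) $$ (i,l)) = (if i = l then of_nat N * mtrace A else 0)"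
proof -
  have "(\<mu> v * A * adj (\<mu> v)) $$ (i,l) =
      (\<Sum>m<N. \<Sum>k<N. A $$ (k,m) * (\<mu> v $$ (i,k) * cnj (\<mu> v $$ (l,m))))" for v
  proof -
    have "(\<mu> v * A * adj (\<mu> v)) $$ (i,l) = (\<Sum>m<N. (\<mu> v * A) $$ (i,m) * adj (\<mu> v) $$ (m,l))"
      by (rule mult_index) (use A il in auto)
    also have "\<dots> = (\<Sum>m<N. (\<Sum>k<N. \<mu> v $$ (i,k) * A $$ (k,m)) * cnj (\<mu> v $$ (l,m)))"
      using A il by (intro sum.cong) (simp_all add: mult_index[of _ N] adj_index[of _ N] del: index_mult_mat(1))
    finally show ?thesis by (simp add: sum_distrib_left sum_distrib_right mult_ac)
  qed
  hence "(\<Sum>v\<in>F2vecs n. (\<mu> v * A * adj (\<mu> v)) $$ (i,l)) =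
      (\<Sum>v\<in>F2vecs n. \<Sum>m<N. \<Sum>k<N. A $$ (k,m) * (\<mu> v $$ (i,k) * cnj (\<mu> v $$ (l,m))))"
    by simp
  also have "\<dots> = (\<Sum>m<N. \<Sum>v\<in>F2vecs n. \<Sum>k<N. A $$ (k,m) * (\<mu> v $$ (i,k) * cnj (\<mu> v $$ (l,m))))"
    by (rule sum.swap)
  also have "\<dots> = (\<Sum>m<N. \<Sum>k<N. \<Sum>v\<in>F2vecs n. A $$ (k,m) * (\<mu> v $$ (i,k) * cnj (\<mu> v $$ (l,m))))"
    by (intro sum.cong refl sum.swap)
  \<comment> \<open>Completeness at the positions \<open>(i,k)\<close> and \<open>(l,m)\<close>
    keeps only the diagonal entries of \<open>A\<close>, and these only if
    \<open>i = l\<close>.\<close>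
  also have "\<dots> = (\<Sum>m<N. \<Sum>k<N. A $$ (k,m) * (if i = l \<and> k = m then of_nat N else 0))"
    using il by (intro sum.cong refl) (simp add: sum_distrib_left[symmetric] mu_complete)
  also have "\<dots> = (if i = l then of_nat N * mtrace A else 0)"
    using A by (auto simp: mtrace_carrier[of _ N] sum_distrib_left mult.commute if_distrib[of "\<lambda>x. _ * x"] cong: if_cong)
  finally show ?thesis .
qed

lemma twirl_trace:
  assumes A: "A \<in> M" and B: "B \<in> M"
  shows "(\<Sum>v\<in>F2vecs n. mtrace (A * (\<mu> v * B * adj (\<mu> v)))) = of_nat N * mtrace A * mtrace B"
proof -
  have "(\<Sum>v\<in>F2vecs n. mtrace (A * (\<mu> v * B * adj (\<mu> v)))) =
      (\<Sum>v\<in>F2vecs n. \<Sum>i<N. \<Sum>k<N. A $$ (i,k) * (\<mu> v * B * adj (\<mu> v)) $$ (k,i))"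
    using A B by (intro sum.cong refl mtrace_mult) auto
  also have "\<dots> = (\<Sum>i<N. \<Sum>v\<in>F2vecs n. \<Sum>k<N. A $$ (i,k) * (\<mu> v * B * adj (\<mu> v)) $$ (k,i))"
    by (rule sum.swap)
  also have "\<dots> = (\<Sum>i<N. \<Sum>k<N. \<Sum>v\<in>F2vecs n. A $$ (i,k) * (\<mu> v * B * adj (\<mu> v)) $$ (k,i))"
    by (intro sum.cong refl sum.swap)
  also have "\<dots> = (\<Sum>i<N. \<Sum>k<N. A $$ (i,k) * (if k = i then of_nat N * mtrace B else 0))"
    using B by (intro sum.cong refl) (simp add: sum_distrib_left[symmetric] twirl_entry del: index_mult_mat)
  also have "\<dots> = of_nat N * mtrace A * mtrace B"
    using A by (simp add: mtrace_carrier[of _ N] sum_distrib_left sum_distrib_right mult_ac if_distrib[of "\<lambda>x. _ * x"] cong: if_cong)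
  finally show ?thesis .
qed

text \<open>The two traces expand into a double sum over positions of \<open>B\<close>, which
  completeness collapses to \<open>p = q\<close>. The map \<open>prod.swap\<close> appears because a
  trace pairs each entry with the transposed one.\<close>

lemma parseval:
  assumes B: "B \<in> M"
  shows "(\<Sum>v\<in>F2vecs n. mtrace (B * \<mu> v) * cnj (mtrace (B * \<mu> v))) = of_nat N * mtrace (B * adj B)"
proof -
  let ?P = "{..<N} \<times> {..<N}"
  have tr: "mtrace (B * \<mu> v) = (\<Sum>p\<in>?P. B $$ p * \<mu> v $$ prod.swap p)" for v
    using B by (simp add: mtrace_mult[of _ N] sum.cartesian_product case_prod_beta prod.swap_def)
  have "(\<Sum>v\<in>F2vecs n. mtrace (B * \<mu> v) * cnj (mtrace (B * \<mu> v))) =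
     (\<Sum>v\<in>F2vecs n. \<Sum>p\<in>?P. \<Sum>q\<in>?P. B $$ p * cnj (B $$ q) * (\<mu> v $$ prod.swap p * cnj (\<mu> v $$ prod.swap q)))"
    unfolding tr by (simp add: cnj_sum sum_product mult_ac)
  also have "\<dots> = (\<Sum>p\<in>?P. \<Sum>v\<in>F2vecs n. \<Sum>q\<in>?P. B $$ p * cnj (B $$ q) * (\<mu> v $$ prod.swap p * cnj (\<mu> v $$ prod.swap q)))"
    by (rule sum.swap)
  also have "\<dots> = (\<Sum>p\<in>?P. \<Sum>q\<in>?P. \<Sum>v\<in>F2vecs n. B $$ p * cnj (B $$ q) * (\<mu> v $$ prod.swap p * cnj (\<mu> v $$ prod.swap q)))"
    by (intro sum.cong refl sum.swap)
  also have "\<dots> = (\<Sum>p\<in>?P. \<Sum>q\<in>?P. B $$ p * cnj (B $$ q) * (if p = q then of_nat N else 0))"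
  proof (intro sum.cong refl)
    fix p q assume "p \<in> ?P" "q \<in> ?P"
    hence "(\<Sum>v\<in>F2vecs n. \<mu> v $$ prod.swap p * cnj (\<mu> v $$ prod.swap q)) = (if p = q then of_nat N else 0)"
      by (cases p; cases q) (auto simp: mu_complete)
    thus "(\<Sum>v\<in>F2vecs n. B $$ p * cnj (B $$ q) * (\<mu> v $$ prod.swap p * cnj (\<mu> v $$ prod.swap q))) =
       B $$ p * cnj (B $$ q) * (if p = q then of_nat N else 0)"
      by (simp add: sum_distrib_left[symmetric])
  qed
  also have "\<dots> = of_nat N * (\<Sum>p\<in>?P. B $$ p * cnj (B $$ p))"
    by (simp add: sum_distrib_left mult_ac if_distrib[of "\<lambda>x. _ * x"] cong: if_cong)
  also have "(\<Sum>p\<in>?P. B $$ p * cnj (B $$ p)) = mtrace (B * adj B)"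
    using B by (simp add: mtrace_mult[of _ N] adj_index[of _ N] sum.cartesian_product case_prod_beta)
  finally show ?thesis .
qed

text \<open>The weight is twice the indicator of even vectors; its sign part is what an inserted
  \<open>J\<close> produces in the twirl.\<close>

lemma sum_even_split:
  "(\<Sum>v\<in>F2vecs n. (1 + (-1) ^ card v) * T v) = 2 * (\<Sum>v\<in>F2vecs_even n. T v :: complex)"
proof -
  have "(\<Sum>v\<in>F2vecs n. (1 + (-1) ^ card v) * T v) = (\<Sum>v\<in>F2vecs_even n. (1 + (-1) ^ card v) * T v)"
    by (rule sum.mono_neutral_right) (auto simp: finite_F2vecs F2vecs_even_def)
  also have "\<dots> = (\<Sum>v\<in>F2vecs_even n. 2 * T v)"
    by (rule sum.cong) (auto simp: F2vecs_even_def)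
  finally show ?thesis by (simp add: sum_distrib_left)
qed

text \<open>Replacing \<open>B\<close> by \<open>J * B\<close> multiplies the term of
  \<open>v\<close> by \<open>(-1)^card v\<close>: \<open>J\<close> passes \<open>\<mu> v\<close>
  with this sign and is then absorbed by \<open>A\<close>. Adding both twirls selects the even
  \<open>v\<close>, and their right-hand sides combine to the trace against
  \<open>even_proj\<close>.\<close>

lemma twirl_trace_even:
  assumes A: "A \<in> M" "A * J = A" and B: "B \<in> M"
  shows "(\<Sum>v\<in>F2vecs_even n. mtrace (A * (\<mu> v * B * adj (\<mu> v)))) = of_nat N * mtrace A * mtrace (even_proj * B)"
proof -
  define T where "T v = mtrace (A * (\<mu> v * B * adj (\<mu> v)))" for v
  have "mtrace (A * (\<mu> v * (J * B) * adj (\<mu> v))) = (-1) ^ card v * T v" if v: "v \<in> F2vecs n" for v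
  proof -
    have "\<mu> v * J = ((-1) ^ card v) \<cdot>\<^sub>m (J * \<mu> v)"
      by (simp add: J_mu[OF v] smult_smult_mat power_mult_distrib[symmetric] one_smult_mat)
    hence "A * (\<mu> v * (J * B) * adj (\<mu> v)) = ((-1) ^ card v) \<cdot>\<^sub>m ((A * J) * (\<mu> v * B * adj (\<mu> v)))"
      using A(1) B by (simp add: assoc_M[symmetric]) (simp add: assoc_M smult_left_M smult_right_M)
    thus ?thesis using A B by (simp add: T_def mtrace_smult[of _ N])
  qed
  hence "(\<Sum>v\<in>F2vecs n. (1 + (-1) ^ card v) * T v) =
     (\<Sum>v\<in>F2vecs n. T v) + (\<Sum>v\<in>F2vecs n. mtrace (A * (\<mu> v * (J * B) * adj (\<mu> v))))"
    by (simp add: distrib_right sum.distrib)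
  also have "\<dots> = 2 * (of_nat N * mtrace A * mtrace (even_proj * B))"
    using twirl_trace[OF A(1) B] twirl_trace[OF A(1), of "J * B"] B
    by (simp add: T_def mtrace_Pi_mult algebra_simps)
  finally show ?thesis unfolding sum_even_split by (simp add: T_def)
qed

section \<open>Associated maps\<close>

lemma unitary_smult_nonzero:
  assumes "unitary_mat N (c \<cdot>\<^sub>m W)" "W \<in> M"
  shows "c \<noteq> 0"
proof
  assume "c = 0"
  hence "mtrace ((c \<cdot>\<^sub>m W) * adj (c \<cdot>\<^sub>m W)) = 0"
    using assms(2) by (simp add: smult_left_M mtrace_smult[of _ N])
  thus False using unitary_cancel(1)[OF assms(1)] by (simp add: mtrace_one)
qed

lemma unitary_smult_norm:
  assumes "unitary_mat N (c \<cdot>\<^sub>m W)" "unitary_mat N W"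
  shows "cmod c = 1"
proof -
  have W: "W \<in> M" using assms(2) by (rule unitary_M)
  have "1\<^sub>m N = (c * cnj c) \<cdot>\<^sub>m 1\<^sub>m N"
    using unitary_cancel(1)[OF assms(1)] W
    by (simp add: adj_smult[of _ N] smult_left_M smult_right_M smult_smult_mat mult.commute unitary_cancel[OF assms(2)])
  hence "mtrace (1\<^sub>m N) = (c * cnj c) * mtrace (1\<^sub>m N)"
    by (metis mtrace_smult one_carrier_mat)
  hence "complex_of_real ((cmod c)^2) = 1"
    by (simp add: mtrace_one complex_norm_square del: of_real_power)
  hence "(cmod c)^2 = 1" by (simp only: of_real_eq_1_iff)
  thus ?thesis by (simp add: power2_eq_1_iff) (use norm_ge_zero[of c] in linarith)
qed

text \<open>The definition admits any scalars \<open>c v\<close>, zero included; a conjugate of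
  \<open>\<mu> v\<close> by a unitary is unitary, which excludes zero.\<close>

lemma assoc_mapE:
  assumes "assoc_map n chi \<gamma> S" "unitary_mat N \<gamma>"
  obtains c where "\<And>v. v \<in> F2vecs n \<Longrightarrow> \<gamma> * \<mu> v * adj \<gamma> = c v \<cdot>\<^sub>m \<mu> (S v)"
    "\<And>v. v \<in> F2vecs n \<Longrightarrow> c v \<noteq> 0"
proof -
  obtain c where c: "\<And>v. v \<in> F2vecs n \<Longrightarrow> \<gamma> * \<mu> v * adj \<gamma> = c v \<cdot>\<^sub>m \<mu> (S v)"
    using assms(1) by (auto simp: assoc_map_def)
  have "c v \<noteq> 0" if "v \<in> F2vecs n" for v
  proof (rule unitary_smult_nonzero)
    show "unitary_mat N (c v \<cdot>\<^sub>m \<mu> (S v))"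
      using assms(2) unfolding c[OF that, symmetric] by (intro unitary_mult mu_unitary unitary_adj)
  qed simp
  with c show ?thesis by (rule that)
qed

lemma assoc_map_F2: "assoc_map n chi \<gamma> S \<Longrightarrow> v \<in> F2vecs n \<Longrightarrow> S v \<in> F2vecs n"
  by (auto simp: assoc_map_def)

text \<open>On \<open>F2vecs n\<close> the two images index proportional operators; outside, both
  maps are undefined in the same way. Hence each group element lies over exactly one map, and
  counting maps is meaningful.\<close>

lemma assoc_map_unique:
  assumes "unitary_mat N \<gamma>" "assoc_map n chi \<gamma> S" "assoc_map n chi \<gamma> S'"
  shows "S = S'"
proof -
  obtain c where c: "\<And>v. v \<in> F2vecs n \<Longrightarrow> \<gamma> * \<mu> v * adj \<gamma> = c v \<cdot>\<^sub>m \<mu> (S v)"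
    "\<And>v. v \<in> F2vecs n \<Longrightarrow> c v \<noteq> 0" using assoc_mapE[OF assms(2,1)] by metis
  obtain c' where c': "\<And>v. v \<in> F2vecs n \<Longrightarrow> \<gamma> * \<mu> v * adj \<gamma> = c' v \<cdot>\<^sub>m \<mu> (S' v)"
    using assoc_mapE[OF assms(3,1)] by metis
  have "S v = S' v" if v: "v \<in> F2vecs n" for v
  proof (rule mu_eq_smult_imp_eq)
    show "\<mu> (S v) = (c' v / c v) \<cdot>\<^sub>m \<mu> (S' v)"
      using smult_cancel[OF c(1)[OF v, symmetric] c(2)[OF v]] by (simp add: c'[OF v] smult_smult_mat)
  qed (use assms v assoc_map_F2 in auto)
  moreover have "S \<in> F2vecs n \<rightarrow>\<^sub>E F2vecs n" "S' \<in> F2vecs n \<rightarrow>\<^sub>E F2vecs n"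
    using assms by (auto simp: assoc_map_def)
  ultimately show ?thesis by (metis PiE_ext)
qed

lemma assoc_map_smult:
  assumes "\<gamma> \<in> M" "assoc_map n chi \<gamma> S"
  shows "assoc_map n chi (z \<cdot>\<^sub>m \<gamma>) S"
proof -
  obtain c where c: "\<And>v. v \<in> F2vecs n \<Longrightarrow> \<gamma> * \<mu> v * adj \<gamma> = c v \<cdot>\<^sub>m \<mu> (S v)"
    using assms(2) by (auto simp: assoc_map_def)
  have "(z \<cdot>\<^sub>m \<gamma>) * \<mu> v * adj (z \<cdot>\<^sub>m \<gamma>) = (cnj z * (z * c v)) \<cdot>\<^sub>m \<mu> (S v)" if "v \<in> F2vecs n" for v
    using c[OF that] assms(1)
    by (simp add: adj_smult[of _ N] smult_left_M smult_right_M smult_smult_mat mult.assoc)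
  thus ?thesis using assms(2) by (auto simp: assoc_map_def)
qed

text \<open>Conjugation by \<open>\<mu> w\<close> only rescales each \<open>\<mu> v\<close>, so the
  change goes into the scalars and leaves \<open>S\<close> alone.\<close>

lemma assoc_map_mult_mu:
  assumes "\<gamma> \<in> M" "assoc_map n chi \<gamma> S" "w \<in> F2vecs n"
  shows "assoc_map n chi (\<gamma> * \<mu> w) S"
proof -
  obtain c where c: "\<And>v. v \<in> F2vecs n \<Longrightarrow> \<gamma> * \<mu> v * adj \<gamma> = c v \<cdot>\<^sub>m \<mu> (S v)"
    using assms(2) by (auto simp: assoc_map_def)
  have "\<exists>d. (\<gamma> * \<mu> w) * \<mu> v * adj (\<gamma> * \<mu> w) = d \<cdot>\<^sub>m \<mu> (S v)" if v: "v \<in> F2vecs n" for v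
  proof -
    obtain s where s: "\<mu> w * \<mu> v = s \<cdot>\<^sub>m (\<mu> v * \<mu> w)" using mu_commute[OF assms(3) v] by blast
    have "(\<gamma> * \<mu> w) * \<mu> v * adj (\<gamma> * \<mu> w) = \<gamma> * (\<mu> w * \<mu> v) * adj (\<mu> w) * adj \<gamma>"
      using assms(1) by (simp add: adj_mult[of _ N] assoc_M)
    also have "\<dots> = s \<cdot>\<^sub>m (\<gamma> * \<mu> v * adj \<gamma>)"
      unfolding s using assms(1)
      by (simp add: smult_left_M smult_right_M assoc_M unitary_cancel[OF mu_unitary])
    finally show ?thesis by (auto simp: c[OF v] smult_smult_mat)
  qed
  hence "\<exists>d. \<forall>v\<in>F2vecs n. (\<gamma> * \<mu> w) * \<mu> v * adj (\<gamma> * \<mu> w) = d v \<cdot>\<^sub>m \<mu> (S v)"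
    by metis
  thus ?thesis using assms(2) by (auto simp: assoc_map_def)
qed

lemma adj_commute_J:
  assumes "unitary_mat N \<gamma>" "\<gamma> * J = J * \<gamma>"
  shows "adj \<gamma> * J = J * adj \<gamma>"
proof -
  have c: "\<gamma> \<in> M" using assms by (simp add: unitary_M)
  have "adj \<gamma> * J = adj \<gamma> * (J * \<gamma>) * adj \<gamma>"
    using c assms(1) by (simp add: assoc_M unitary_cancel)
  thus ?thesis using c assms(1) unfolding assms(2)[symmetric] by (simp add: assoc_M unitary_cancel)
qed

text \<open>A form of Schur's lemma: the twirl of such an \<open>A\<close> is \<open>N * N\<close>
  copies of \<open>A\<close>, yet every twirl is a multiple of the identity.\<close>

lemma central_imp_scalar:
  assumes A: "A \<in> M" and com: "\<And>v. v \<in> F2vecs n \<Longrightarrow> \<mu> v * A * adj (\<mu> v) = A"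
  shows "A = (mtrace A / of_nat N) \<cdot>\<^sub>m 1\<^sub>m N"
proof (rule eq_matI)
  fix i l assume "i < dim_row ((mtrace A / of_nat N) \<cdot>\<^sub>m 1\<^sub>m N)" "l < dim_col ((mtrace A / of_nat N) \<cdot>\<^sub>m 1\<^sub>m N)"
  hence il: "i < N" "l < N" by auto
  have "of_nat (N * N) * A $$ (i,l) = (\<Sum>v\<in>F2vecs n. (\<mu> v * A * adj (\<mu> v)) $$ (i,l))"
    using com by (simp add: card_F2vecs)
  also have "\<dots> = (if i = l then of_nat N * mtrace A else 0)"
    by (rule twirl_entry[OF A il])
  finally show "A $$ (i,l) = ((mtrace A / of_nat N) \<cdot>\<^sub>m 1\<^sub>m N) $$ (i,l)"
    using il by (auto simp: field_simps split: if_splits)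
qed (use A in auto)

text \<open>Modulo phases, parity-preserving elements over one \<open>S\<close> differ by an even
  \<open>\<mu> w\<close>. Their quotient \<open>\<delta>\<close> rescales every
  \<open>\<mu> v\<close>, which forces it to be a phase times a single
  \<open>\<mu> w\<close>.\<close>

lemma same_assoc_map:
  assumes \<gamma>: "unitary_mat N \<gamma>" "\<gamma> * J = J * \<gamma>" "assoc_map n chi \<gamma> S"
    and \<gamma>': "unitary_mat N \<gamma>'" "\<gamma>' * J = J * \<gamma>'" "assoc_map n chi \<gamma>' S"
  obtains z w where "cmod z = 1" "w \<in> F2vecs_even n" "\<gamma>' = z \<cdot>\<^sub>m (\<gamma> * \<mu> w)"
proof -
  define \<delta> where "\<delta> = adj \<gamma> * \<gamma>'"
  have gM: "\<gamma> \<in> M" "\<gamma>' \<in> M" using \<gamma> \<gamma>' by (auto simp: unitary_M)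
  have U: "unitary_mat N \<delta>" unfolding \<delta>_def using \<gamma> \<gamma>' by (intro unitary_mult unitary_adj)
  hence dM: "\<delta> \<in> M" by (rule unitary_M)
  have dJ: "\<delta> * J = J * \<delta>"
    using gM \<gamma>'(2) adj_commute_J[OF \<gamma>(1,2)]
    by (simp add: \<delta>_def assoc_M) (simp add: assoc_M[symmetric])
  obtain c where c: "\<And>v. v \<in> F2vecs n \<Longrightarrow> \<gamma> * \<mu> v * adj \<gamma> = c v \<cdot>\<^sub>m \<mu> (S v)"
    "\<And>v. v \<in> F2vecs n \<Longrightarrow> c v \<noteq> 0" using assoc_mapE[OF \<gamma>(3,1)] by metis
  obtain c' where c': "\<And>v. v \<in> F2vecs n \<Longrightarrow> \<gamma>' * \<mu> v * adj \<gamma>' = c' v \<cdot>\<^sub>m \<mu> (S v)"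
    using assoc_mapE[OF \<gamma>'(3,1)] by metis
  \<comment> \<open>Both conjugations send \<open>\<mu> v\<close> to multiples of the same
    \<open>\<mu> (S v)\<close>, so conjugation by \<open>\<delta>\<close> only rescales
    \<open>\<mu> v\<close>.\<close>
  have d: "\<mu> v * adj \<delta> = (c' v / c v) \<cdot>\<^sub>m (adj \<delta> * \<mu> v)" if v: "v \<in> F2vecs n" for v
  proof -
    have "\<mu> (S v) = (1 / c v) \<cdot>\<^sub>m (\<gamma> * \<mu> v * adj \<gamma>)"
      by (rule smult_cancel[OF c(1)[OF v, symmetric] c(2)[OF v]])
    hence e: "\<gamma>' * \<mu> v * adj \<gamma>' = (c' v / c v) \<cdot>\<^sub>m (\<gamma> * \<mu> v * adj \<gamma>)"
      by (simp add: c'[OF v] smult_smult_mat)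
    have "\<mu> v * adj \<delta> = adj \<gamma>' * (\<gamma>' * \<mu> v * adj \<gamma>') * \<gamma>"
      using gM by (simp add: \<delta>_def adj_mult[of _ N] adj_adj[of _ N] assoc_M unitary_cancel[OF \<gamma>'(1)])
    also have "\<dots> = (c' v / c v) \<cdot>\<^sub>m (adj \<delta> * \<mu> v)"
      unfolding e using gM
      by (simp add: \<delta>_def adj_mult[of _ N] adj_adj[of _ N] smult_left_M smult_right_M assoc_M unitary_cancel[OF \<gamma>(1)])
    finally show ?thesis .
  qed
  \<comment> \<open>By Parseval the squared overlaps of the unitary \<open>adj \<delta>\<close> add
    up to \<open>N * N\<close>, so some \<open>w\<close> has a nonzero overlap.\<close>
  have "(\<Sum>w\<in>F2vecs n. mtrace (adj \<delta> * \<mu> w) * cnj (mtrace (adj \<delta> * \<mu> w))) \<noteq> 0"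
    using dM by (simp add: parseval adj_adj[of _ N] unitary_cancel[OF U] mtrace_one)
  then obtain w where w: "w \<in> F2vecs n" "mtrace (adj \<delta> * \<mu> w) \<noteq> 0"
    by (metis (no_types, lifting) mult_zero_left sum.neutral)
  \<comment> \<open>conjugation by \<open>\<mu> v\<close> rescales \<open>A\<close>; as \<open>mtrace A \<noteq> 0\<close> the factor is 1, so \<open>A\<close> is central\<close>
  define A where "A = adj \<delta> * \<mu> w"
  have AM: "A \<in> M" using dM by (simp add: A_def)
  have "\<mu> v * A * adj (\<mu> v) = A" if v: "v \<in> F2vecs n" for v
  proof -
    obtain s where s: "\<mu> v * \<mu> w = s \<cdot>\<^sub>m (\<mu> w * \<mu> v)" using mu_commute[OF v w(1)] by blast
    have "\<mu> v * A * adj (\<mu> v) = (\<mu> v * adj \<delta>) * \<mu> w * adj (\<mu> v)"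
      using dM by (simp add: A_def assoc_M)
    also have "\<dots> = (c' v / c v) \<cdot>\<^sub>m (adj \<delta> * (\<mu> v * \<mu> w) * adj (\<mu> v))"
      unfolding d[OF v] using dM by (simp add: smult_left_M assoc_M)
    also have "\<dots> = (c' v / c v * s) \<cdot>\<^sub>m A"
      unfolding s using dM
      by (simp add: A_def smult_left_M smult_right_M smult_smult_mat assoc_M unitary_cancel[OF mu_unitary])
    finally have eq: "\<mu> v * A * adj (\<mu> v) = (c' v / c v * s) \<cdot>\<^sub>m A" .
    have "mtrace (\<mu> v * (A * adj (\<mu> v))) = mtrace (A * adj (\<mu> v) * \<mu> v)"
      using AM by (intro mtrace_mult_comm[of _ N]) auto
    hence "(c' v / c v * s) * mtrace A = mtrace A"
      using eq AM by (simp add: assoc_M unitary_cancel[OF mu_unitary] mtrace_smult[of _ N])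
    hence "c' v / c v * s = 1" using w(2) by (simp add: A_def field_simps c(2)[OF v])
    thus ?thesis by (simp add: eq one_smult_mat)
  qed
  hence "A = (mtrace A / of_nat N) \<cdot>\<^sub>m 1\<^sub>m N" by (rule central_imp_scalar[OF AM])
  then obtain z where z: "A = z \<cdot>\<^sub>m 1\<^sub>m N" by blast
  have "unitary_mat N A" unfolding A_def by (intro unitary_mult unitary_adj U mu_unitary)
  hence zn: "cmod z = 1" unfolding z by (rule unitary_smult_norm) (rule unitary_one)
  have "\<delta> * A = \<mu> w" using dM by (simp add: A_def unitary_cancel[OF U])
  hence muw: "\<mu> w = z \<cdot>\<^sub>m \<delta>" using dM by (simp add: z smult_right_M)
  have "\<gamma>' = \<gamma> * \<delta>" using gM by (simp add: \<delta>_def unitary_cancel[OF \<gamma>(1)])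
  also have "\<delta> = (1/z) \<cdot>\<^sub>m \<mu> w" by (rule smult_cancel) (use muw zn in auto)
  finally have 1: "\<gamma>' = (1/z) \<cdot>\<^sub>m (\<gamma> * \<mu> w)" using gM by (simp add: smult_right_M)
  \<comment> \<open>for odd \<open>w\<close> the operator \<open>\<mu> w\<close> would both commute and anticommute with \<open>J\<close>\<close>
  have "even (card w)"
  proof (rule ccontr)
    assume odd: "odd (card w)"
    have "J * \<mu> w = \<mu> w * J" unfolding muw using dM dJ by (simp add: smult_left_M smult_right_M)
    with J_mu[OF w(1)] odd have eq: "\<mu> w * J = (-1) \<cdot>\<^sub>m (\<mu> w * J)" by simp
    have "unitary_mat N (\<mu> w * J)" by (intro unitary_mult mu_unitary)
    hence "mtrace ((\<mu> w * J) * adj (\<mu> w * J)) = of_nat N" by (simp add: unitary_cancel mtrace_one)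
    moreover have "mtrace ((\<mu> w * J) * adj (\<mu> w * J)) = - mtrace ((\<mu> w * J) * adj (\<mu> w * J))"
      by (subst eq) (simp add: smult_left_M mtrace_smult[of _ N])
    ultimately show False by simp
  qed
  hence "w \<in> F2vecs_even n" using w by (simp add: F2vecs_even_def)
  with 1 zn show ?thesis by (intro that[of "1/z" w]) (auto simp: norm_divide)
qed

end

section \<open>The parity-restricted trace\<close>

text \<open>Translation by a \<open>w\<close> with \<open>ch w \<noteq> 1\<close> permutes
  \<open>H\<close> and multiplies the sum by \<open>ch w\<close>, so the sum is zero.\<close>

lemma character_sum:
  fixes ch :: "nat set \<Rightarrow> complex"
  assumes "finite H" and closed: "\<And>v w. v \<in> H \<Longrightarrow> w \<in> H \<Longrightarrow> vadd v w \<in> H"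
    and mult: "\<And>v w. v \<in> H \<Longrightarrow> w \<in> H \<Longrightarrow> ch (vadd v w) = ch v * ch w"
  shows "sum ch H = 0 \<or> sum ch H = of_nat (card H)"
proof (cases "\<forall>w\<in>H. ch w = 1")
  case True
  thus ?thesis by simp
next
  case False
  then obtain w where w: "w \<in> H" "ch w \<noteq> 1" by blast
  have "sum ch H = (\<Sum>v\<in>H. ch (vadd w v))"
    by (rule sum.reindex_bij_witness[where i = "vadd w" and j = "vadd w"])
       (auto simp: closed w vadd_assoc[symmetric])
  also have "\<dots> = ch w * sum ch H"
    using w by (simp add: mult sum_distrib_left)
  finally show ?thesis using w by auto
qed

context majorana
begin

lemma trace_sq_dichotomy:
  assumes \<gamma>: "unitary_mat N \<gamma>" "\<gamma> * J = J * \<gamma>" "assoc_map n chi \<gamma> S"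
  shows "(cmod (mtrace (even_proj * \<gamma>)))^2 = 0 \<or>
    (cmod (mtrace (even_proj * \<gamma>)))^2 = (real (f_plus n S) + real (c_plus n S)) / 2"
proof -
  have gM: "\<gamma> \<in> M" using \<gamma> by (simp add: unitary_M)
  obtain c where c: "\<And>v. v \<in> F2vecs n \<Longrightarrow> \<gamma> * \<mu> v * adj \<gamma> = c v \<cdot>\<^sub>m \<mu> (S v)"
    "\<And>v. v \<in> F2vecs n \<Longrightarrow> c v \<noteq> 0" using assoc_mapE[OF \<gamma>(3,1)] by metis
  define H where "H = {v \<in> F2vecs_even n. S v = v \<or> S v = vadd v (jvec n)}"
  \<comment> \<open>\<open>Q\<close> is the scaling relation under the projector; \<open>ch\<close>
    reads the scalar off by a trace and so makes sense for all \<open>v\<close>. The factor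
    \<open>2 / N\<close> inverts the trace of \<open>even_proj\<close>.\<close>
  define Q where "Q v x \<longleftrightarrow> even_proj * (\<gamma> * \<mu> v * adj \<gamma>) = x \<cdot>\<^sub>m (even_proj * \<mu> v)" for v x
  define ch where "ch v = mtrace (even_proj * (\<gamma> * \<mu> v * adj \<gamma>) * adj (\<mu> v)) * 2 / of_nat N" for v
  have fin: "finite (F2vecs_even n)" by (simp add: F2vecs_even_def finite_F2vecs)
  have Q_ch: "ch v = x" if "Q v x" for v x
  proof -
    have "even_proj * (\<gamma> * \<mu> v * adj \<gamma>) * adj (\<mu> v) = x \<cdot>\<^sub>m even_proj"
      using that unfolding Q_def by (simp add: smult_left_M assoc_M unitary_cancel[OF mu_unitary])
    thus ?thesis by (simp add: ch_def mtrace_smult[of _ N] mtrace_Pi)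
  qed
  \<comment> \<open>The projector commutes with the even operator \<open>\<mu> v\<close>, so it can
    serve first one conjugated factor and then the other. The phase of
    \<open>\<mu> v * \<mu> w\<close> occurs on both sides and cancels.\<close>
  have Q_mult: "Q (vadd v w) (x * y)" if vw: "v \<in> F2vecs_even n" "w \<in> F2vecs_even n" "Q v x" "Q w y" for v w x y
  proof -
    obtain s where s: "cmod s = 1" "\<mu> v * \<mu> w = s \<cdot>\<^sub>m \<mu> (vadd v w)"
      using mu_mult[OF even_F2[OF vw(1)]] by blast
    have s': "\<mu> (vadd v w) = (1/s) \<cdot>\<^sub>m (\<mu> v * \<mu> w)"
      using s(1) by (intro smult_cancel[OF s(2)[symmetric]]) auto
    have Pc: "even_proj * \<mu> v = \<mu> v * even_proj" using J_mu_even[OF vw(1)] by (intro Pi_commute) auto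
    have "even_proj * (\<gamma> * (\<mu> v * \<mu> w) * adj \<gamma>) = (even_proj * (\<gamma> * \<mu> v * adj \<gamma>)) * (\<gamma> * \<mu> w * adj \<gamma>)"
      using gM by (simp add: assoc_M unitary_cancel[OF \<gamma>(1)])
    also have "\<dots> = x \<cdot>\<^sub>m (\<mu> v * (even_proj * (\<gamma> * \<mu> w * adj \<gamma>)))"
      using vw(3) gM unfolding Q_def Pc by (simp add: smult_left_M assoc_M)
    also have "\<dots> = (x * y) \<cdot>\<^sub>m ((\<mu> v * even_proj) * \<mu> w)"
      using vw(4) gM unfolding Q_def by (simp add: smult_right_M smult_smult_mat assoc_M)
    also have "\<dots> = (x * y) \<cdot>\<^sub>m (even_proj * (\<mu> v * \<mu> w))"
      unfolding Pc[symmetric] by (simp add: assoc_M)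
    finally show ?thesis
      unfolding Q_def s' using gM by (simp add: smult_left_M smult_right_M smult_smult_mat mult_ac)
  qed
  have H_Q: "\<exists>x. x \<noteq> 0 \<and> Q v x" if v: "v \<in> H" for v
  proof -
    have ve: "v \<in> F2vecs_even n" "v \<in> F2vecs n" using v by (auto simp: H_def even_F2)
    obtain s where s: "cmod s = 1" "J * \<mu> v = s \<cdot>\<^sub>m \<mu> (vadd (jvec n) v)"
      using mu_mult[OF jvec_F2] by blast
    \<comment> \<open>As \<open>even_proj\<close> absorbs \<open>J\<close>, the shift by
      \<open>jvec n\<close> costs only the phase \<open>s\<close>: the scalar is \<open>c v\<close>
      if \<open>v\<close> is fixed and \<open>c v / s\<close> if it is shifted.\<close>
    have "even_proj * \<mu> v = s \<cdot>\<^sub>m (even_proj * \<mu> (vadd v (jvec n)))"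
      using s(2) Pi_J by (metis assoc_M mu_M Pi_M smult_right_M vadd_commute)
    hence "even_proj * \<mu> (vadd v (jvec n)) = (1/s) \<cdot>\<^sub>m (even_proj * \<mu> v)"
      using s(1) by (intro smult_cancel) auto
    moreover have "even_proj * (\<gamma> * \<mu> v * adj \<gamma>) = c v \<cdot>\<^sub>m (even_proj * \<mu> (S v))"
      unfolding c(1)[OF ve(2)] by (simp add: smult_right_M)
    ultimately have "Q v (c v) \<or> Q v (c v / s)"
      using v unfolding Q_def H_def by (auto simp: smult_smult_mat)
    moreover have "c v / s \<noteq> 0" using c(2)[OF ve(2)] s(1) by auto
    ultimately show ?thesis using c(2)[OF ve(2)] by blast
  qed
  have notH: "ch v = 0" if v: "v \<in> F2vecs_even n" "v \<notin> H" for v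
  proof -
    have vF: "v \<in> F2vecs n" "S v \<in> F2vecs n" using v even_F2 assoc_map_F2[OF \<gamma>(3)] by auto
    let ?u = "vadd (S v) v"
    have uF: "?u \<in> F2vecs n" using vF by (simp add: vadd_F2vecs)
    obtain s where s: "\<mu> (S v) * adj (\<mu> v) = s \<cdot>\<^sub>m \<mu> ?u" using mu_mult_adj[OF vF(2,1)] by blast
    obtain r where r: "J * \<mu> ?u = r \<cdot>\<^sub>m \<mu> (vadd (jvec n) ?u)" using mu_mult[OF jvec_F2] by blast
    \<comment> \<open>Off \<open>H\<close> the vector \<open>?u\<close> is neither zero nor
      \<open>jvec n\<close>, so \<open>\<mu> ?u\<close> and \<open>J * \<mu> ?u\<close> are both
      traceless.\<close>
    have "?u \<noteq> {}" "vadd (jvec n) ?u \<noteq> {}"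
      using v by (auto simp: H_def vadd_eq_iff) (auto simp: H_def vadd_def)
    hence "mtrace (even_proj * \<mu> ?u) = 0"
      using uF by (simp add: mtrace_Pi_mult r mtrace_smult[of _ N] mtrace_mu vadd_F2vecs)
    moreover have "even_proj * (\<gamma> * \<mu> v * adj \<gamma>) * adj (\<mu> v) = (c v * s) \<cdot>\<^sub>m (even_proj * \<mu> ?u)"
      unfolding c(1)[OF vF(1)] by (simp add: smult_left_M smult_right_M smult_smult_mat assoc_M s)
    ultimately show ?thesis by (simp add: ch_def mtrace_smult[of _ N])
  qed
  have H_sub: "H \<subseteq> F2vecs_even n" by (auto simp: H_def)
  have ch: "ch v \<noteq> 0" "Q v (ch v)" if "v \<in> H" for v
    using H_Q[OF that] Q_ch by metis+
  have ch_mult: "ch (vadd v w) = ch v * ch w" if "v \<in> H" "w \<in> H" for v w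
    using that H_sub ch by (intro Q_ch Q_mult) auto
  \<comment> \<open>Closure comes from \<open>ch\<close>, not from \<open>S\<close>:
    \<open>ch (vadd v w)\<close> is a product of nonzero values, whereas \<open>ch\<close> vanishes
    at even vectors outside \<open>H\<close>.\<close>
  have H_closed: "vadd v w \<in> H" if "v \<in> H" "w \<in> H" for v w
    using ch_mult[OF that] ch(1)[OF that(1)] ch(1)[OF that(2)] notH[of "vadd v w"] that H_sub vadd_even[of v n w]
    by auto
  \<comment> \<open>The even twirl is used with \<open>even_proj * \<gamma>\<close> and
    \<open>adj \<gamma>\<close>: the two traces multiply to the squared modulus, and the term of
    \<open>v\<close> is \<open>N/2\<close> times \<open>ch v\<close>.\<close>
  have "of_nat N * (mtrace (even_proj * \<gamma>) * cnj (mtrace (even_proj * \<gamma>))) = of_nat N / 2 * sum ch H"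
  proof -
    have AJ: "even_proj * \<gamma> * J = even_proj * \<gamma>"
      using gM \<gamma>(2) Pi_J by (metis assoc_M mu_M Pi_M)
    have "cnj (mtrace (even_proj * \<gamma>)) = mtrace (adj (even_proj * \<gamma>))"
      using gM by (intro mtrace_adj[symmetric, of _ N]) auto
    also have "\<dots> = mtrace (adj \<gamma> * even_proj)"
      using gM by (simp add: adj_mult[of _ N] Pi_adj)
    also have "\<dots> = mtrace (even_proj * adj \<gamma>)"
      using gM by (intro mtrace_mult_comm[of _ N]) auto
    finally have "of_nat N * (mtrace (even_proj * \<gamma>) * cnj (mtrace (even_proj * \<gamma>))) =
        (\<Sum>v\<in>F2vecs_even n. mtrace (even_proj * \<gamma> * (\<mu> v * adj \<gamma> * adj (\<mu> v))))"
      using twirl_trace_even[OF _ AJ, of "adj \<gamma>"] gM by simp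
    also have "\<dots> = (\<Sum>v\<in>F2vecs_even n. of_nat N / 2 * ch v)"
      using gM by (intro sum.cong refl) (simp add: ch_def assoc_M)
    also have "\<dots> = (\<Sum>v\<in>H. of_nat N / 2 * ch v)"
      using fin H_sub notH by (intro sum.mono_neutral_right) auto
    finally show ?thesis by (simp add: sum_distrib_left)
  qed
  hence "mtrace (even_proj * \<gamma>) * cnj (mtrace (even_proj * \<gamma>)) = sum ch H / 2"
    by (simp add: field_simps)
  hence sq: "complex_of_real ((cmod (mtrace (even_proj * \<gamma>)))^2) = sum ch H / 2"
    by (simp add: complex_norm_square del: of_real_power)
  have finH: "finite H" using fin H_sub by (rule rev_finite_subset)
  have "card H = f_plus n S + c_plus n S"
  proof -
    have "H = {v \<in> F2vecs_even n. S v = v} \<union> {v \<in> F2vecs_even n. S v = vadd v (jvec n)}"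
      by (auto simp: H_def)
    moreover have "vadd v (jvec n) \<noteq> v" for v
      using jvec_nonempty by (metis vadd_left_cancel vadd_empty(1))
    hence "{v \<in> F2vecs_even n. S v = v} \<inter> {v \<in> F2vecs_even n. S v = vadd v (jvec n)} = {}"
      by auto
    ultimately show ?thesis
      using fin by (simp add: f_plus_def c_plus_def card_Un_disjoint)
  qed
  moreover have "sum ch H = 0 \<or> sum ch H = of_nat (card H)"
    by (rule character_sum[OF finH H_closed ch_mult])
  ultimately have "complex_of_real ((cmod (mtrace (even_proj * \<gamma>)))^2) = complex_of_real 0 \<or>
      complex_of_real ((cmod (mtrace (even_proj * \<gamma>)))^2) = complex_of_real ((real (f_plus n S) + real (c_plus n S)) / 2)"
    unfolding sq by auto
  thus ?thesis unfolding of_real_eq_iff .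
qed

section \<open>Moments over the translates of one element by even \<mu> w\<close>

lemma card_F2vecs_even: "real (card (F2vecs_even n)) = real N * real N / 2"
proof -
  \<comment> \<open>The even twirl of the identity counts vectors: each term is \<open>N/2\<close>,
    the trace of \<open>even_proj\<close>, and the total is \<open>N * (N/2)^2\<close>.\<close>
  have "(\<Sum>v\<in>F2vecs_even n. mtrace (even_proj * (\<mu> v * 1\<^sub>m N * adj (\<mu> v)))) = of_nat N * mtrace even_proj * mtrace (even_proj * 1\<^sub>m N)"
    by (rule twirl_trace_even) (auto simp: Pi_J)
  hence "of_nat (card (F2vecs_even n)) * (of_nat N / 2) = of_nat N * (of_nat N / 2) * (of_nat N / 2 :: complex)"
    by (simp add: unitary_cancel[OF mu_unitary] mtrace_Pi)
  hence "of_nat (card (F2vecs_even n)) = complex_of_real (real N * real N / 2)"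
    by (simp add: mult.commute)
  thus ?thesis by (metis of_real_eq_iff of_real_of_nat_eq)
qed

text \<open>Parseval for \<open>B = even_proj * \<gamma>\<close>. Since \<open>B\<close> absorbs
  \<open>J\<close> on both sides and an odd \<open>\<mu> w\<close> anticommutes with
  \<open>J\<close>, odd terms vanish; the total is \<open>N\<close> times the trace of
  \<open>even_proj\<close>.\<close>

lemma sum_trace_sq:
  assumes \<gamma>: "unitary_mat N \<gamma>" "\<gamma> * J = J * \<gamma>"
  shows "(\<Sum>w\<in>F2vecs_even n. (cmod (mtrace (even_proj * (\<gamma> * \<mu> w))))^2) = real N * real N / 2"
proof -
  have gM: "\<gamma> \<in> M" using \<gamma> by (simp add: unitary_M)
  define B where "B = even_proj * \<gamma>"
  have BM: "B \<in> M" using gM by (simp add: B_def)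
  have BJ: "B * J = B" using gM \<gamma>(2) Pi_J unfolding B_def by (metis assoc_M mu_M Pi_M)
  have JB: "J * B = B"
    using gM Pi_commute[OF mu_M refl] Pi_J unfolding B_def by (simp add: assoc_M[symmetric])
  have zero: "mtrace (B * \<mu> w) = 0" if w: "w \<in> F2vecs n" "odd (card w)" for w
  proof -
    have "mtrace (B * \<mu> w) = mtrace (B * (J * \<mu> w))"
      using BM BJ by (simp add: assoc_M[symmetric])
    also have "\<dots> = - mtrace (B * \<mu> w * J)"
      using BM w by (simp add: J_mu smult_right_M mtrace_smult[of _ N] assoc_M)
    also have "mtrace (B * \<mu> w * J) = mtrace (J * (B * \<mu> w))"
      using BM by (intro mtrace_mult_comm[of _ N]) auto
    also have "\<dots> = mtrace (B * \<mu> w)" using BM JB by (simp add: assoc_M[symmetric])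
    finally show ?thesis by simp
  qed
  have "complex_of_real (\<Sum>w\<in>F2vecs_even n. (cmod (mtrace (B * \<mu> w)))^2) =
      (\<Sum>w\<in>F2vecs_even n. mtrace (B * \<mu> w) * cnj (mtrace (B * \<mu> w)))"
    by (simp add: complex_norm_square del: of_real_power)
  also have "\<dots> = (\<Sum>w\<in>F2vecs n. mtrace (B * \<mu> w) * cnj (mtrace (B * \<mu> w)))"
    using zero by (intro sum.mono_neutral_left) (auto simp: finite_F2vecs F2vecs_even_def)
  also have "\<dots> = of_nat N * mtrace (B * adj B)" by (rule parseval[OF BM])
  also have "B * adj B = even_proj"
    using gM by (simp add: B_def adj_mult[of _ N] Pi_adj assoc_M unitary_cancel[OF \<gamma>(1)] Pi_idem)
  finally have "complex_of_real (\<Sum>w\<in>F2vecs_even n. (cmod (mtrace (B * \<mu> w)))^2) = complex_of_real (real N * real N / 2)"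
    by (simp add: mtrace_Pi)
  hence "(\<Sum>w\<in>F2vecs_even n. (cmod (mtrace (B * \<mu> w)))^2) = real N * real N / 2"
    unfolding of_real_eq_iff .
  thus ?thesis using gM by (simp add: B_def assoc_M)
qed

lemma sum_trace_power:
  assumes \<gamma>: "unitary_mat N \<gamma>" "\<gamma> * J = J * \<gamma>" "assoc_map n chi \<gamma> S" and t: "t \<ge> 1"
  shows "(\<Sum>w\<in>F2vecs_even n. cmod (mtrace (even_proj * (\<gamma> * \<mu> w))) ^ (2*t)) =
    ((real (f_plus n S) + real (c_plus n S)) / 2) ^ (t - 1) * (real N * real N / 2)"
proof -
  let ?K = "(real (f_plus n S) + real (c_plus n S)) / 2"
  have gM: "\<gamma> \<in> M" using \<gamma> by (simp add: unitary_M)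
  have "cmod (mtrace (even_proj * (\<gamma> * \<mu> w))) ^ (2*t) = ?K ^ (t - 1) * (cmod (mtrace (even_proj * (\<gamma> * \<mu> w))))^2"
    if w: "w \<in> F2vecs_even n" for w
  proof -
    have "(cmod (mtrace (even_proj * (\<gamma> * \<mu> w))))^2 = 0 \<or> (cmod (mtrace (even_proj * (\<gamma> * \<mu> w))))^2 = ?K"
    proof (rule trace_sq_dichotomy)
      show "unitary_mat N (\<gamma> * \<mu> w)" by (intro unitary_mult \<gamma> mu_unitary)
      have "\<gamma> * \<mu> w * J = \<gamma> * J * \<mu> w" using gM J_mu_even[OF w] by (simp add: assoc_M)
      also have "\<dots> = J * (\<gamma> * \<mu> w)" unfolding \<gamma>(2) using gM by (simp add: assoc_M)
      finally show "\<gamma> * \<mu> w * J = J * (\<gamma> * \<mu> w)" .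
      show "assoc_map n chi (\<gamma> * \<mu> w) S" by (rule assoc_map_mult_mu[OF gM \<gamma>(3) even_F2[OF w]])
    qed
    \<comment> \<open>Here \<open>t \<ge> 1\<close> matters: at \<open>x = 0\<close> and
      \<open>t = 0\<close> the left side would be 1 and the right side 0.\<close>
    moreover have "x ^ t = ?K ^ (t - 1) * x" if "x = 0 \<or> x = ?K" for x :: real
    proof -
      obtain m where "t = Suc m" using t by (cases t) auto
      thus ?thesis using that by (elim disjE) (simp, metis diff_Suc_1 power_Suc2)
    qed
    ultimately show ?thesis unfolding power_mult by blast
  qed
  thus ?thesis by (simp add: sum_distrib_left[symmetric] sum_trace_sq[OF \<gamma>(1,2)])
qed

end

section \<open>Counting classes modulo phases\<close>

lemma phase_rel_equiv:
  assumes "\<And>U. U \<in> \<G> \<Longrightarrow> U \<in> carrier_mat N N"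
  shows "equiv \<G> (phase_rel \<G>)"
proof (rule equivI)
  show "phase_rel \<G> \<subseteq> \<G> \<times> \<G>" by (auto simp: phase_rel_def)
  show "refl_on \<G> (phase_rel \<G>)"
    by (auto simp: refl_on_def phase_rel_def one_smult_mat intro!: exI[of _ 1])
  show "sym (phase_rel \<G>)"
  proof (rule symI)
    fix U V assume "(U, V) \<in> phase_rel \<G>"
    then obtain z where z: "U \<in> \<G>" "V \<in> \<G>" "cmod z = 1" "U = z \<cdot>\<^sub>m V" by (auto simp: phase_rel_def)
    have "V = (1/z) \<cdot>\<^sub>m U" using z by (auto simp: smult_smult_mat one_smult_mat)
    thus "(V, U) \<in> phase_rel \<G>" using z by (auto simp: phase_rel_def norm_divide intro!: exI[of _ "1/z"])
  qed
  show "trans (phase_rel \<G>)"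
  proof (rule transI)
    fix U V W assume "(U, V) \<in> phase_rel \<G>" "(V, W) \<in> phase_rel \<G>"
    then obtain y z where "U \<in> \<G>" "W \<in> \<G>" "cmod y = 1" "U = y \<cdot>\<^sub>m V" "cmod z = 1" "V = z \<cdot>\<^sub>m W"
      by (auto simp: phase_rel_def)
    thus "(U, W) \<in> phase_rel \<G>"
      by (auto simp: phase_rel_def smult_smult_mat norm_mult intro!: exI[of _ "y * z"])
  qed
qed

locale majorana_group = majorana +
  fixes \<G> :: "complex mat set"
  assumes grp: "unitary_subgroup (2^n) \<G>"
    and lower: "Majorana_even n chi \<subseteq> \<G>"
    and upper: "\<G> \<subseteq> Clifford_p n chi"
begin

abbreviation R where "R \<equiv> phase_rel \<G>"

definition rep :: "complex mat set \<Rightarrow> complex mat" where "rep X = (SOME U. U \<in> X)"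

lemma G_unitary: "U \<in> \<G> \<Longrightarrow> unitary_mat N U"
  and G_one: "1\<^sub>m N \<in> \<G>"
  and G_mult: "U \<in> \<G> \<Longrightarrow> V \<in> \<G> \<Longrightarrow> U * V \<in> \<G>"
  and G_adj: "U \<in> \<G> \<Longrightarrow> adj U \<in> \<G>"
  using grp by (auto simp: unitary_subgroup_def)

lemma G_M: "U \<in> \<G> \<Longrightarrow> U \<in> M"
  using G_unitary unitary_M by blast

lemma G_J: "U \<in> \<G> \<Longrightarrow> U * J = J * U"
  using upper by (auto simp: Clifford_p_def)

lemma G_assoc: "U \<in> \<G> \<Longrightarrow> \<exists>S. assoc_map n chi U S"
  using upper by (auto simp: Clifford_p_def Clifford_def)

lemma mu_in_G: "w \<in> F2vecs_even n \<Longrightarrow> \<mu> w \<in> \<G>"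
  using lower by (auto simp: Majorana_even_def one_smult_mat intro!: subsetD[OF lower] exI[of _ 0] exI[of _ w])

lemma equiv_R: "equiv \<G> R"
  by (rule phase_rel_equiv[of _ N]) (rule G_M)

lemma rep_in:
  assumes "X \<in> \<G> // R"
  shows "rep X \<in> X" "rep X \<in> \<G>" "R `` {rep X} = X"
proof -
  from assms obtain U where U: "U \<in> \<G>" "X = R `` {U}" by (rule quotientE)
  hence "U \<in> X" using equiv_R equiv_class_self by fast
  thus 1: "rep X \<in> X" unfolding rep_def by (rule someI)
  hence r: "(U, rep X) \<in> R" using U by simp
  thus "rep X \<in> \<G>" by (auto simp: phase_rel_def)
  show "R `` {rep X} = X" using equiv_class_eq[OF equiv_R r] U by simp
qed

lemma class_eq_iff: "U \<in> \<G> \<Longrightarrow> V \<in> \<G> \<Longrightarrow> R `` {U} = R `` {V} \<longleftrightarrow> (\<exists>z. cmod z = 1 \<and> U = z \<cdot>\<^sub>m V)"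
  using eq_equiv_class_iff[OF equiv_R] by (auto simp: phase_rel_def)

lemma rep_class:
  assumes "U \<in> \<G>"
  obtains z where "cmod z = 1" "rep (R `` {U}) = z \<cdot>\<^sub>m U"
proof -
  have "R `` {U} \<in> \<G> // R" using assms by (rule quotientI)
  from rep_in(2,3)[OF this] show ?thesis
    using class_eq_iff[of "rep (R `` {U})" U] assms that by blast
qed

definition trace_pow :: "nat \<Rightarrow> complex mat \<Rightarrow> real" where
  "trace_pow t U = cmod (mtrace (even_proj * U)) ^ (2*t)"

lemma trace_pow_smult: "cmod z = 1 \<Longrightarrow> U \<in> M \<Longrightarrow> trace_pow t (z \<cdot>\<^sub>m U) = trace_pow t U"
  by (simp add: trace_pow_def smult_right_M mtrace_smult[of _ N] norm_mult)

lemma trace_pow_rep: "U \<in> \<G> \<Longrightarrow> trace_pow t (rep (R `` {U})) = trace_pow t U"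
  by (metis rep_class trace_pow_smult G_M)

text \<open>Invariance of the uniform measure on classes under right translation, which reduces the
  double expectation to a single one.\<close>

lemma sum_translate:
  assumes V: "V \<in> \<G>"
  shows "(\<Sum>X\<in>\<G> // R. trace_pow t (rep X * adj V)) = (\<Sum>X\<in>\<G> // R. trace_pow t (rep X))"
proof -
  \<comment> \<open>Multiplying chosen representatives by \<open>W\<close> and then by its inverse
    \<open>W'\<close> returns to \<open>rep X\<close> only up to a phase, which the class
    forgets.\<close>
  have key: "R `` {rep (R `` {rep X * W}) * W'} = X"
    if X: "X \<in> \<G> // R" and W: "W \<in> \<G>" "W' \<in> \<G>" "W * W' = 1\<^sub>m N" for X W W'
  proof -
    note X' = rep_in[OF X]
    obtain z where z: "cmod z = 1" "rep (R `` {rep X * W}) = z \<cdot>\<^sub>m (rep X * W)"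
      using rep_class[OF G_mult[OF X'(2) W(1)]] .
    have zX: "rep (R `` {rep X * W}) * W' = z \<cdot>\<^sub>m rep X"
      unfolding z(2) using W G_M X' by (simp add: smult_left_M assoc_M)
    have "rep (R `` {rep X * W}) \<in> \<G>"
      using rep_in(2)[OF quotientI] G_mult[OF X'(2) W(1)] by blast
    hence "z \<cdot>\<^sub>m rep X \<in> \<G>" unfolding zX[symmetric] using W by (intro G_mult)
    hence "R `` {z \<cdot>\<^sub>m rep X} = R `` {rep X}" using class_eq_iff X' z by blast
    thus ?thesis using zX X' by simp
  qed
  show ?thesis
  proof (rule sum.reindex_bij_witness[where j = "\<lambda>X. R `` {rep X * adj V}" and i = "\<lambda>X. R `` {rep X * V}"])
    fix X assume X: "X \<in> \<G> // R"
    show "R `` {rep (R `` {rep X * adj V}) * V} = X"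
      using X V by (intro key) (auto simp: G_adj unitary_cancel[OF G_unitary])
    show "R `` {rep (R `` {rep X * V}) * adj V} = X"
      using X V by (intro key) (auto simp: G_adj unitary_cancel[OF G_unitary])
    show "R `` {rep X * adj V} \<in> \<G> // R" "R `` {rep X * V} \<in> \<G> // R"
      using V rep_in(2)[OF X] by (auto intro!: quotientI G_mult G_adj)
    show "trace_pow t (rep (R `` {rep X * adj V})) = trace_pow t (rep X * adj V)"
      using V rep_in(2)[OF X] by (intro trace_pow_rep G_mult G_adj)
  qed
qed

section \<open>Phase classes sorted by their associated maps\<close>

abbreviation "Maps \<equiv> assoc_maps n chi \<G>"

definition lift :: "(nat set \<Rightarrow> nat set) \<Rightarrow> complex mat" where
  "lift S = (SOME \<gamma>. \<gamma> \<in> \<G> \<and> assoc_map n chi \<gamma> S)"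

lemma lift: "S \<in> Maps \<Longrightarrow> lift S \<in> \<G>" "S \<in> Maps \<Longrightarrow> assoc_map n chi (lift S) S"
proof -
  assume "S \<in> Maps"
  hence "\<exists>\<gamma>. \<gamma> \<in> \<G> \<and> assoc_map n chi \<gamma> S" by (auto simp: assoc_maps_def)
  from someI_ex[OF this] show "lift S \<in> \<G>" "assoc_map n chi (lift S) S"
    by (simp_all add: lift_def)
qed

text \<open>Coordinates on the quotient: \<open>S\<close> is recovered by uniqueness of the
  associated map, and \<open>w\<close> by cancelling \<open>lift S\<close> and comparing basis
  operators. That every class is reached is \<open>same_assoc_map\<close>.\<close>

lemma bij_classes:
  "bij_betw (\<lambda>(S,w). R `` {lift S * \<mu> w}) (Maps \<times> F2vecs_even n) (\<G> // R)"
proof (rule bij_betw_imageI)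
  show "inj_on (\<lambda>(S,w). R `` {lift S * \<mu> w}) (Maps \<times> F2vecs_even n)"
  proof (rule inj_onI, clarify)
    fix S w S' w'
    assume S: "S \<in> Maps" "S' \<in> Maps" and w: "w \<in> F2vecs_even n" "w' \<in> F2vecs_even n"
      and eq: "R `` {lift S * \<mu> w} = R `` {lift S' * \<mu> w'}"
    have inG: "lift S * \<mu> w \<in> \<G>" "lift S' * \<mu> w' \<in> \<G>"
      using S w by (auto intro!: G_mult lift mu_in_G)
    then obtain z where z: "cmod z = 1" "lift S * \<mu> w = z \<cdot>\<^sub>m (lift S' * \<mu> w')"
      using eq class_eq_iff by blast
    have "assoc_map n chi (lift S * \<mu> w) S"
      using S w by (intro assoc_map_mult_mu G_M lift even_F2)
    moreover have "assoc_map n chi (lift S * \<mu> w) S'"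
      unfolding z(2) using S w inG by (intro assoc_map_smult assoc_map_mult_mu G_M lift even_F2)
    ultimately have SS: "S = S'" by (rule assoc_map_unique[OF G_unitary[OF inG(1)]])
    have U: "unitary_mat N (lift S)" using S by (intro G_unitary lift)
    have "adj (lift S) * (lift S * \<mu> w) = adj (lift S) * (z \<cdot>\<^sub>m (lift S * \<mu> w'))"
      using z(2) SS by simp
    hence "\<mu> w = z \<cdot>\<^sub>m \<mu> w'"
      using unitary_M[OF U] by (simp add: smult_right_M unitary_cancel[OF U])
    hence "w = w'" using w by (intro mu_eq_smult_imp_eq even_F2)
    with SS show "S = S' \<and> w = w'" by simp
  qed
  show "(\<lambda>(S,w). R `` {lift S * \<mu> w}) ` (Maps \<times> F2vecs_even n) = \<G> // R"
  proof (intro equalityI subsetI)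
    fix X assume "X \<in> (\<lambda>(S,w). R `` {lift S * \<mu> w}) ` (Maps \<times> F2vecs_even n)"
    thus "X \<in> \<G> // R" by (auto intro!: quotientI G_mult lift mu_in_G)
  next
    fix X assume "X \<in> \<G> // R"
    then obtain U where U: "U \<in> \<G>" "X = R `` {U}" by (rule quotientE)
    obtain S where S: "assoc_map n chi U S" using G_assoc[OF U(1)] by blast
    hence SM: "S \<in> Maps" using U by (auto simp: assoc_maps_def)
    obtain z w where zw: "cmod z = 1" "w \<in> F2vecs_even n" "U = z \<cdot>\<^sub>m (lift S * \<mu> w)"
      using same_assoc_map[OF G_unitary[OF lift(1)[OF SM]] G_J[OF lift(1)[OF SM]] lift(2)[OF SM]
          G_unitary[OF U(1)] G_J[OF U(1)] S] .
    have "lift S * \<mu> w \<in> \<G>" using SM zw by (intro G_mult lift mu_in_G)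
    hence "R `` {U} = R `` {lift S * \<mu> w}"
      using class_eq_iff U zw by blast
    thus "X \<in> (\<lambda>(S,w). R `` {lift S * \<mu> w}) ` (Maps \<times> F2vecs_even n)"
      using U SM zw by (intro image_eqI[of _ _ "(S,w)"]) auto
  qed
qed

lemma finite_Maps: "finite Maps"
  by (rule finite_subset[of _ "F2vecs n \<rightarrow>\<^sub>E F2vecs n"])
     (auto simp: assoc_maps_def assoc_map_def finite_F2vecs intro!: finite_PiE)

lemma sum_classes:
  "(\<Sum>X\<in>\<G> // R. trace_pow t (rep X)) = (\<Sum>S\<in>Maps. \<Sum>w\<in>F2vecs_even n. trace_pow t (lift S * \<mu> w))"
proof -
  have "(\<Sum>X\<in>\<G> // R. trace_pow t (rep X)) =
      (\<Sum>p\<in>Maps \<times> F2vecs_even n. trace_pow t (rep (case p of (S,w) \<Rightarrow> R `` {lift S * \<mu> w})))"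
    by (rule sum.reindex_bij_betw[OF bij_classes, symmetric])
  also have "\<dots> = (\<Sum>p\<in>Maps \<times> F2vecs_even n. trace_pow t (lift (fst p) * \<mu> (snd p)))"
    by (rule sum.cong) (auto intro!: trace_pow_rep G_mult lift mu_in_G)
  also have "\<dots> = (\<Sum>S\<in>Maps. \<Sum>w\<in>F2vecs_even n. trace_pow t (lift S * \<mu> w))"
    by (simp add: sum.cartesian_product case_prod_beta)
  finally show ?thesis .
qed

lemma card_classes: "real (card (\<G> // R)) = real (card Maps) * (real N * real N / 2)"
  unfolding card_F2vecs_even[symmetric] bij_betw_same_card[OF bij_classes, symmetric]
  by (simp add: card_cartesian_product)

lemma frame_potential:
  assumes t: "t \<ge> 1"
  shows "frame_potential_plus n chi t \<G> =
    (1 / real (card Maps)) * (\<Sum>S\<in>Maps. ((real (f_plus n S) + real (c_plus n S)) / 2) ^ (t - 1))"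
proof -
  let ?K = "\<lambda>S. ((real (f_plus n S) + real (c_plus n S)) / 2) ^ (t - 1)"
  define q where "q = real (card (\<G> // R))"
  define h where "h = real N * real N / 2"
  have h: "h > 0" by (simp add: h_def)
  \<comment> \<open>The identity lies in the group and has an associated map, so \<open>Maps\<close>
    is nonempty and the division is genuine.\<close>
  obtain S0 where "assoc_map n chi (1\<^sub>m N) S0" using G_assoc[OF G_one] by blast
  hence "Maps \<noteq> {}" using G_one by (auto simp: assoc_maps_def)
  hence cM: "real (card Maps) > 0" using finite_Maps by (simp add: card_gt_0_iff)
  have q: "q = real (card Maps) * h" unfolding q_def h_def by (rule card_classes)
  have S: "(\<Sum>X\<in>\<G> // R. trace_pow t (rep X)) = (\<Sum>S\<in>Maps. ?K S) * h"
    unfolding sum_classes sum_distrib_right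
  proof (rule sum.cong)
    fix S assume "S \<in> Maps"
    thus "(\<Sum>w\<in>F2vecs_even n. trace_pow t (lift S * \<mu> w)) = ?K S * h"
      unfolding h_def trace_pow_def by (intro sum_trace_power t G_unitary G_J lift)
  qed simp
  have "frame_potential_plus n chi t \<G> = (\<Sum>X\<in>\<G> // R. \<Sum>Y\<in>\<G> // R. trace_pow t (rep X * adj (rep Y))) / q^2"
    unfolding frame_potential_plus_def Let_def q_def rep_def[symmetric] trace_pow_def
    by (intro arg_cong2[where f = "(/)"] sum.cong refl)
       (simp add: assoc_M G_M rep_in)
  also have "(\<Sum>X\<in>\<G> // R. \<Sum>Y\<in>\<G> // R. trace_pow t (rep X * adj (rep Y))) =
      (\<Sum>Y\<in>\<G> // R. \<Sum>X\<in>\<G> // R. trace_pow t (rep X * adj (rep Y)))"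
    by (rule sum.swap)
  also have "\<dots> = q * (\<Sum>X\<in>\<G> // R. trace_pow t (rep X))"
    by (simp add: sum_translate rep_in q_def)
  \<comment> \<open>With \<open>q = card Maps * h\<close>, the quotient
    \<open>q * (sum * h) / q^2\<close> loses every factor \<open>h\<close> and one factor
    \<open>card Maps\<close>.\<close>
  finally show ?thesis
    using h cM by (simp add: S q power2_eq_square field_simps)
qed

end

theorem mainTheorem15:
  fixes n t :: nat and chi :: "nat \<Rightarrow> complex mat" and \<G> :: "complex mat set"
  assumes "n \<ge> 1"
    and "majorana_family n chi"
    and "unitary_subgroup (2^n) \<G>"
    and "Majorana_even n chi \<subseteq> \<G>"
    and "\<G> \<subseteq> Clifford_p n chi"
    and "t \<ge> 1"
  shows "frame_potential_plus n chi t \<G> =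
    (1 / real (card (assoc_maps n chi \<G>))) *
    (\<Sum>S\<in>assoc_maps n chi \<G>. ((real (f_plus n S) + real (c_plus n S)) / 2) ^ (t - 1))"
proof -
  interpret majorana_group n chi \<G>
    using assms by unfold_locales auto
  show ?thesis using assms(6) by (rule frame_potential)
qed

end
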